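(* Every closed infinite-dimensional subspace $M$ of $\mathcal B$ contains a closed subspace isomorphic to $\ell_2$ which is complemented in $\mathcal B$.
   Context: Let $\mathcal T$ be the dyadic tree (unique root, every node has exactly two immediate successors), with nodes enumerated by $\mathbb N$ so that the tree order $\preceq$ satisfies $n\preceq m\Rightarrow n\le m$. A segment is a subset $s\subseteq\mathcal T$ totally ordered by $\preceq$ such that $n,m\in s$, $n\preceq k\preceq m$ imply $k\in s$. For $x=(x(t))_{t\in\mathcal T}\in c_0$, $\|x\|_{JT}=\sup\big(\sum_{j=1}^k(\sum_{t\in s_j}x(t))^2\big)^{1/2}$ over all $k$ and pairwise disjoint finite segments $s_1,\dots,s_k$; $JT=\{x\in c_0:\|x\|_{JT}<\infty\}$. The unit vectors $(e_t)_{t\in\mathcal T}$ form a basis of $JT$; let $(e_t^* )\subset JT^*$ be the biorthogonal functionals and $\mathcal B=\overline{\operatorname{span}}\{e_t^*:t\in\mathcal T\}\subset JT^*$ (so that $\mathcal B^*=JT$ canonically). *)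

theory Defs
  imports "HOL-Analysis.Analysis"
begin

text \<open>Root 0; the immediate successors of n are 2n+1 and 2n+2. Hence the
parent of m > 0 is (m - 1) div 2, and n \<preceq> m implies n \<le> m.\<close>

definition tparent :: "nat \<Rightarrow> nat" where
  "tparent m = (m - 1) div 2"

definition tree_le :: "nat \<Rightarrow> nat \<Rightarrow> bool" where
  "tree_le n m \<longleftrightarrow> (\<exists>k. (tparent ^^ k) m = n)"

definition segment :: "nat set \<Rightarrow> bool" where
  "segment s \<longleftrightarrow>
     (\<forall>n\<in>s. \<forall>m\<in>s. tree_le n m \<or> tree_le m n) \<and>
     (\<forall>n\<in>s. \<forall>m\<in>s. \<forall>k. tree_le n k \<and> tree_le k m \<longrightarrow> k \<in> s)"

definition jt_sums :: "(nat \<Rightarrow> real) \<Rightarrow> real set" where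
  "jt_sums x = {sqrt (\<Sum>s\<in>S. (\<Sum>t\<in>s. x t)\<^sup>2) | S.
      finite S \<and> (\<forall>s\<in>S. finite s \<and> segment s) \<and> pairwise disjnt S}"

definition jt_norm :: "(nat \<Rightarrow> real) \<Rightarrow> real" where
  "jt_norm x = Sup (jt_sums x)"

definition JT :: "(nat \<Rightarrow> real) set" where
  "JT = {x. x \<longlonglongrightarrow> 0 \<and> bdd_above (jt_sums x)}"

definition fin_supp :: "(nat \<Rightarrow> real) \<Rightarrow> bool" where
  "fin_supp x \<longleftrightarrow> finite {t. x t \<noteq> 0}"

text \<open>A functional f in span of the biorthogonal functionals, or in its closure in JT*,
is determined by its coefficients a t = f(e_t); its JT*-norm is the supremum of
|f(x)| over finitely supported x (which are dense in JT) with jt_norm x \<le> 1.\<close>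

definition B_pairings :: "(nat \<Rightarrow> real) \<Rightarrow> real set" where
  "B_pairings a = {\<bar>\<Sum>t\<in>{t. x t \<noteq> 0}. a t * x t\<bar> | x. fin_supp x \<and> jt_norm x \<le> 1}"

definition B_norm :: "(nat \<Rightarrow> real) \<Rightarrow> real" where
  "B_norm a = Sup (B_pairings a)"

definition B_bounded :: "(nat \<Rightarrow> real) \<Rightarrow> bool" where
  "B_bounded a \<longleftrightarrow> bdd_above (B_pairings a)"

definition Bsp :: "(nat \<Rightarrow> real) set" where
  "Bsp = {a. \<forall>\<epsilon>>0. \<exists>b. fin_supp b \<and> B_bounded (\<lambda>t. a t - b t)
                         \<and> B_norm (\<lambda>t. a t - b t) < \<epsilon>}"

definition lin_subspace :: "(nat \<Rightarrow> real) set \<Rightarrow> bool" where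
  "lin_subspace M \<longleftrightarrow> (\<lambda>t. 0) \<in> M \<and>
     (\<forall>a\<in>M. \<forall>b\<in>M. (\<lambda>t. a t + b t) \<in> M) \<and>
     (\<forall>c::real. \<forall>a\<in>M. (\<lambda>t. c * a t) \<in> M)"

definition B_closed :: "(nat \<Rightarrow> real) set \<Rightarrow> bool" where
  "B_closed M \<longleftrightarrow> (\<forall>u a. (\<forall>n. u n \<in> M) \<and> a \<in> Bsp \<and>
        (\<lambda>n. B_norm (\<lambda>t. u n t - a t)) \<longlonglongrightarrow> 0 \<longrightarrow> a \<in> M)"

definition infinite_dim :: "(nat \<Rightarrow> real) set \<Rightarrow> bool" where
  "infinite_dim M \<longleftrightarrow> (\<forall>n. \<exists>v::nat \<Rightarrow> nat \<Rightarrow> real. (\<forall>i<n. v i \<in> M) \<and>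
      (\<forall>c::nat \<Rightarrow> real. (\<forall>t. (\<Sum>i<n. c i * v i t) = 0) \<longrightarrow> (\<forall>i<n. c i = 0)))"

definition l2 :: "(nat \<Rightarrow> real) set" where
  "l2 = {x. summable (\<lambda>n. (x n)\<^sup>2)}"

definition l2_norm :: "(nat \<Rightarrow> real) \<Rightarrow> real" where
  "l2_norm x = sqrt (\<Sum>n. (x n)\<^sup>2)"

definition iso_to_l2 :: "(nat \<Rightarrow> real) set \<Rightarrow> bool" where
  "iso_to_l2 Y \<longleftrightarrow> (\<exists>T :: (nat \<Rightarrow> real) \<Rightarrow> (nat \<Rightarrow> real).
      T ` l2 = Y \<and>
      (\<forall>x\<in>l2. \<forall>y\<in>l2. T (\<lambda>n. x n + y n) = (\<lambda>t. T x t + T y t)) \<and>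
      (\<forall>c::real. \<forall>x\<in>l2. T (\<lambda>n. c * x n) = (\<lambda>t. c * T x t)) \<and>
      (\<exists>c C. 0 < c \<and> 0 < C \<and>
         (\<forall>x\<in>l2. c * l2_norm x \<le> B_norm (T x) \<and> B_norm (T x) \<le> C * l2_norm x)))"

definition complemented_in_B :: "(nat \<Rightarrow> real) set \<Rightarrow> bool" where
  "complemented_in_B Y \<longleftrightarrow> (\<exists>P :: (nat \<Rightarrow> real) \<Rightarrow> (nat \<Rightarrow> real).
      P ` Bsp = Y \<and>
      (\<forall>a\<in>Bsp. P (P a) = P a) \<and>
      (\<forall>a\<in>Bsp. \<forall>b\<in>Bsp. P (\<lambda>t. a t + b t) = (\<lambda>t. P a t + P b t)) \<and>
      (\<forall>c::real. \<forall>a\<in>Bsp. P (\<lambda>t. c * a t) = (\<lambda>t. c * P a t)) \<and>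
      (\<exists>C. \<forall>a\<in>Bsp. B_norm (P a) \<le> C * B_norm a))"

end

theory Submission
  imports Defs "HOL-Library.Diagonal_Subsequence"
begin

text \<open>
  For a sequence of consecutive intervals of nodes, the squares of the norms of the restrictions
  of x add up to at most the square of the norm of x, so block sequences in B have an
  upper 2-estimate. It therefore suffices to find, in a given subspace M, an almost disjointly
  supported sequence g and a biorthogonal sequence w of finitely supported vectors in JT
  that has an upper 2-estimate as well: then a \<mapsto> \<Sum>k. a(w k) g k is the projection.

  Choose m n in M with disjoint norming blocks x n. For every e > 0 the branches
  along which x n is larger than e fall, up to where x n starts, into boundedly many classes.
  Passing to a subsequence, each class converges and the sums of x n along the limits converge
  too, so that the differences x (2 n + 1) - x (2 n) become small along these limits. A branch then
  meets at most one large difference on each scale, which gives the upper 2-estimate on a fast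
  subsequence; the corresponding differences of the m n still pair with them to at least 1/2.
\<close>

subsection \<open>The tree\<close>

text \<open>The delicate estimate is the one in JT, where a general bounded block sequence has no
  upper 2-estimate: \<open>N\<close> unit vectors on one branch have a sum of norm at least
  \<open>N\<close>. What has to be removed is the mass that the blocks keep along common branches,
  and subtracting two terms with nearly equal limits removes it. Sums from the root to a node
  (\<open>asum\<close>) stand in for sums along branches, so infinite branches never occur. The
  smallness thresholds \<open>(1/2) ^ hi n\<close> depend on where block n ends and not just on n: a
  family can contain as many segments starting in a block as the block has nodes, and the squared
  errors must be summable over all of them. Disjoint segments have distinct first nodes, so an error
  of order \<open>(1/4) ^ Min s\<close> per segment is affordable. The upper estimate for w doubles
  as the lower estimate for g: testing a functional on a combination of the w k bounds its
  coefficients in l2. The w k arise from the differences by solving a triangular system, since g n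
  vanishes before its block but keeps a small tail after it.\<close>

lemma tparent_pow_le: "(tparent ^^ k) m \<le> m"
  by (induction k) (auto simp: tparent_def)

lemma tree_le_imp_le: "tree_le n m \<Longrightarrow> n \<le> m"
  using tparent_pow_le by (auto simp: tree_le_def)

lemma tree_le_refl [simp]: "tree_le n n"
  unfolding tree_le_def by (rule exI[of _ 0]) simp

lemma tree_le_trans: "tree_le a b \<Longrightarrow> tree_le b c \<Longrightarrow> tree_le a c"
proof -
  assume "tree_le a b" "tree_le b c"
  then obtain i j where "(tparent ^^ i) b = a" "(tparent ^^ j) c = b"
    by (auto simp: tree_le_def)
  then have "(tparent ^^ (i + j)) c = a" by (simp add: funpow_add)
  then show ?thesis by (auto simp: tree_le_def)
qed

text \<open>The ancestors of a node are the iterates of \<open>tparent\<close> on it, hence a chain,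
  and the number order decides which of two comes first.\<close>

lemma tree_le_of_common_descendant:
  assumes "tree_le u v" "tree_le w v" "u \<le> w"
  shows "tree_le u w"
proof -
  obtain i j where i: "(tparent ^^ i) v = u" and j: "(tparent ^^ j) v = w"
    using assms by (auto simp: tree_le_def)
  show ?thesis
  proof (cases "j \<le> i")
    case True
    then have "(tparent ^^ (i - j)) w = u"
      using i funpow_add[of "i - j" j tparent] by (simp add: j[symmetric])
    then show ?thesis by (auto simp: tree_le_def)
  next
    case False
    then have "(tparent ^^ (j - i)) u = w"
      using j funpow_add[of "j - i" i tparent] by (simp add: i[symmetric])
    then have "w \<le> u" using tparent_pow_le by blast
    with assms show ?thesis by simp
  qed
qed

definition anc :: "nat \<Rightarrow> nat set" where
  "anc v = {u. tree_le u v}"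

lemma finite_anc [simp]: "finite (anc v)"
  by (rule finite_subset[of _ "{..v}"]) (auto simp: anc_def tree_le_imp_le)

lemma segment_Int_atLeastLessThan: "segment s \<Longrightarrow> segment (s \<inter> {a..<b})"
  unfolding segment_def by (fastforce dest: tree_le_imp_le)

lemma segment_anc: "segment (anc v)"
  unfolding segment_def anc_def
  by (metis mem_Collect_eq nat_le_linear tree_le_of_common_descendant tree_le_trans)

lemma segment_anc_atLeast: "segment (anc v \<inter> {a..})"
proof -
  have "anc v \<inter> {a..} = anc v \<inter> {a..<Suc v}"
    by (auto simp: anc_def less_Suc_eq_le tree_le_imp_le)
  then show ?thesis by (simp add: segment_anc segment_Int_atLeastLessThan)
qed

text \<open>Convexity makes a finite segment the whole tree path between its extreme nodes. Beyond
  \<open>Min s\<close> it is thus indistinguishable from the path from the root to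
  \<open>Max s\<close>.\<close>

lemma segment_eq_anc:
  assumes "segment s" "finite s" "s \<noteq> {}"
  shows "s = anc (Max s) \<inter> {Min s..}"
proof -
  have M: "Max s \<in> s" "Min s \<in> s" using assms by auto
  have *: "tree_le w (Max s)" if "w \<in> s" for w
    using assms M that unfolding segment_def
    by (metis Max_ge le_antisym tree_le_imp_le tree_le_refl)
  have "w \<in> s" if "tree_le w (Max s)" "Min s \<le> w" for w
  proof -
    have "tree_le (Min s) w"
      using tree_le_of_common_descendant[OF *[OF M(2)]] that by blast
    then show ?thesis using assms(1) M that unfolding segment_def by blast
  qed
  with * show ?thesis using assms by (auto simp: anc_def)
qed

lemma anc_lessThan_eq:
  assumes "w \<in> anc v" "p \<le> w"
  shows "anc v \<inter> {..<p} = anc w \<inter> {..<p}"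
proof -
  have "tree_le u w" if "tree_le u v" "u < p" for u
    using tree_le_of_common_descendant[OF that(1), of w] assms that by (simp add: anc_def)
  then show ?thesis
    using assms tree_le_trans[of _ w v] by (auto simp: anc_def)
qed

subsection \<open>The norm of JT on finitely supported vectors\<close>

lemma fin_supp_iff: "fin_supp x \<longleftrightarrow> (\<exists>L. \<forall>t\<ge>L. x t = 0)"
proof
  assume "fin_supp x"
  then obtain L where "{t. x t \<noteq> 0} \<subseteq> {..<L}"
    using finite_nat_iff_bounded unfolding fin_supp_def by blast
  then show "\<exists>L. \<forall>t\<ge>L. x t = 0" by (intro exI[of _ L]) force
next
  assume "\<exists>L. \<forall>t\<ge>L. x t = 0"
  then obtain L where "\<And>t. L \<le> t \<Longrightarrow> x t = 0" by blast
  then have "{t. x t \<noteq> 0} \<subseteq> {..<L}" by (auto simp: not_le[symmetric])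
  then show "fin_supp x" unfolding fin_supp_def using finite_subset by blast
qed

lemma fin_supp_zero [simp]: "fin_supp (\<lambda>t. 0)"
  by (simp add: fin_supp_def)

lemma fin_supp_add [intro]: "fin_supp x \<Longrightarrow> fin_supp y \<Longrightarrow> fin_supp (\<lambda>t. x t + y t)"
  unfolding fin_supp_def
  by (rule finite_subset[of _ "{t. x t \<noteq> 0} \<union> {t. y t \<noteq> 0}"]) auto

lemma fin_supp_diff [intro]: "fin_supp x \<Longrightarrow> fin_supp y \<Longrightarrow> fin_supp (\<lambda>t. x t - y t)"
  unfolding fin_supp_def
  by (rule finite_subset[of _ "{t. x t \<noteq> 0} \<union> {t. y t \<noteq> 0}"]) auto

lemma fin_supp_mult [intro]: "fin_supp x \<Longrightarrow> fin_supp (\<lambda>t. c * x t)"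
  unfolding fin_supp_def by (erule finite_subset[rotated]) auto

lemma fin_supp_sum [intro]:
  "(\<And>i. i \<in> I \<Longrightarrow> fin_supp (x i)) \<Longrightarrow> fin_supp (\<lambda>t. \<Sum>i\<in>I. x i t)"
  by (induction I rule: infinite_finite_induct) auto

definition restr :: "nat set \<Rightarrow> (nat \<Rightarrow> real) \<Rightarrow> nat \<Rightarrow> real" where
  "restr A x = (\<lambda>t. if t \<in> A then x t else 0)"

lemma fin_supp_restr [intro]: "fin_supp x \<Longrightarrow> fin_supp (restr A x)"
  unfolding fin_supp_def restr_def by (erule finite_subset[rotated]) auto

definition seg_family :: "nat set set \<Rightarrow> bool" where
  "seg_family S \<longleftrightarrow> finite S \<and> (\<forall>s\<in>S. finite s \<and> segment s) \<and> pairwise disjnt S"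

lemma seg_family_empty: "seg_family {}"
  by (simp add: seg_family_def)

lemma jt_sums_eq: "jt_sums x = {L2_set (\<lambda>s. sum x s) S | S. seg_family S}"
  by (simp add: jt_sums_def seg_family_def L2_set_def)

lemma bdd_above_jt_sums:
  assumes "fin_supp x"
  shows "bdd_above (jt_sums x)"
proof -
  define D where "D = {t. x t \<noteq> 0}"
  have fD: "finite D" using assms by (simp add: D_def fin_supp_def)
  have "L2_set (\<lambda>s. sum x s) S \<le> (\<Sum>t\<in>D. \<bar>x t\<bar>)" if S: "seg_family S" for S
  proof -
    have *: "\<bar>sum x s\<bar> \<le> (\<Sum>t\<in>s \<inter> D. \<bar>x t\<bar>)" if "s \<in> S" for s
    proof -
      have "sum x s = sum x (s \<inter> D)"
        using that S by (intro sum.mono_neutral_right) (auto simp: D_def seg_family_def)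
      then show ?thesis using sum_abs[of x "s \<inter> D"] by simp
    qed
    have "L2_set (\<lambda>s. sum x s) S \<le> (\<Sum>s\<in>S. \<bar>sum x s\<bar>)" by (rule L2_set_le_sum_abs)
    also have "\<dots> \<le> (\<Sum>s\<in>S. \<Sum>t\<in>s \<inter> D. \<bar>x t\<bar>)" by (intro sum_mono *)
    also have "\<dots> = (\<Sum>t\<in>(\<Union>s\<in>S. s \<inter> D). \<bar>x t\<bar>)"
      using S fD by (subst sum.UNION_disjoint)
        (auto simp: seg_family_def pairwise_def disjnt_def)
    also have "\<dots> \<le> (\<Sum>t\<in>D. \<bar>x t\<bar>)"
      using fD by (intro sum_mono2) auto
    finally show ?thesis .
  qed
  then show ?thesis unfolding jt_sums_eq by (intro bdd_aboveI[of _ "\<Sum>t\<in>D. \<bar>x t\<bar>"]) auto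
qed

lemma seg_family_L2_le_jt_norm:
  assumes "fin_supp x" "seg_family S"
  shows "L2_set (\<lambda>s. sum x s) S \<le> jt_norm x"
  unfolding jt_norm_def using assms
  by (intro cSup_upper bdd_above_jt_sums) (auto simp: jt_sums_eq)

lemma jt_norm_leI:
  assumes "\<And>S. seg_family S \<Longrightarrow> L2_set (\<lambda>s. sum x s) S \<le> D"
  shows "jt_norm x \<le> D"
  unfolding jt_norm_def using assms seg_family_empty
  by (intro cSup_least) (auto simp: jt_sums_eq)

lemma jt_norm_nonneg: "fin_supp x \<Longrightarrow> 0 \<le> jt_norm x"
  using seg_family_L2_le_jt_norm[OF _ seg_family_empty] by simp

lemma seg_family_sum_le_jt_norm:
  assumes "fin_supp x" "seg_family S"
  shows "(\<Sum>s\<in>S. (sum x s)\<^sup>2) \<le> (jt_norm x)\<^sup>2"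
  using seg_family_L2_le_jt_norm[OF assms]
  by (simp add: L2_set_def real_sqrt_le_iff' sqrt_le_D)

lemma jt_norm_square_leI:
  assumes "\<And>S. seg_family S \<Longrightarrow> (\<Sum>s\<in>S. (sum x s)\<^sup>2) \<le> D" "fin_supp x"
  shows "(jt_norm x)\<^sup>2 \<le> D"
proof -
  have "0 \<le> D" using assms(1)[OF seg_family_empty] by simp
  have "jt_norm x \<le> sqrt D"
    by (rule jt_norm_leI) (simp add: L2_set_def assms(1))
  then have "(jt_norm x)\<^sup>2 \<le> (sqrt D)\<^sup>2"
    by (rule power_mono) (simp add: jt_norm_nonneg assms)
  then show ?thesis using \<open>0 \<le> D\<close> by simp
qed

lemma segment_sum_le_jt_norm:
  assumes "fin_supp x" "segment s" "finite s"
  shows "\<bar>sum x s\<bar> \<le> jt_norm x"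
  using seg_family_L2_le_jt_norm[of x "{s}"] assms by (simp add: seg_family_def)

lemma abs_le_jt_norm:
  assumes "fin_supp x"
  shows "\<bar>x t\<bar> \<le> jt_norm x"
proof -
  have "segment {t}" by (auto simp: segment_def dest!: tree_le_imp_le)
  then show ?thesis using segment_sum_le_jt_norm[OF assms, of "{t}"] by simp
qed

lemma jt_norm_zero [simp]: "jt_norm (\<lambda>t. 0) = 0"
proof (rule antisym)
  show "jt_norm (\<lambda>t. 0) \<le> 0" by (rule jt_norm_leI) (simp add: L2_set_def)
qed (simp add: jt_norm_nonneg)

lemma jt_norm_eq_0D: "fin_supp x \<Longrightarrow> jt_norm x = 0 \<Longrightarrow> x t = 0"
  using abs_le_jt_norm[of x t] by simp

lemma jt_norm_triangle:
  assumes "fin_supp x" "fin_supp y"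
  shows "jt_norm (\<lambda>t. x t + y t) \<le> jt_norm x + jt_norm y"
proof (rule jt_norm_leI)
  fix S assume S: "seg_family S"
  have "L2_set (\<lambda>s. \<Sum>t\<in>s. x t + y t) S \<le> L2_set (sum x) S + L2_set (sum y) S"
    using L2_set_triangle_ineq[of "sum x" "sum y" S] by (simp add: sum.distrib)
  also have "\<dots> \<le> jt_norm x + jt_norm y"
    by (intro add_mono seg_family_L2_le_jt_norm assms S)
  finally show "L2_set (\<lambda>s. \<Sum>t\<in>s. x t + y t) S \<le> jt_norm x + jt_norm y" .
qed

lemma jt_norm_mult_le:
  assumes "fin_supp x"
  shows "jt_norm (\<lambda>t. c * x t) \<le> \<bar>c\<bar> * jt_norm x"
proof (rule jt_norm_leI)
  fix S assume S: "seg_family S"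
  have "L2_set (\<lambda>s. \<Sum>t\<in>s. c * x t) S = \<bar>c\<bar> * L2_set (sum x) S"
    by (simp add: L2_set_def sum_distrib_left[symmetric] power_mult_distrib real_sqrt_mult)
  also have "\<dots> \<le> \<bar>c\<bar> * jt_norm x"
    by (intro mult_left_mono seg_family_L2_le_jt_norm assms S) simp
  finally show "L2_set (\<lambda>s. \<Sum>t\<in>s. c * x t) S \<le> \<bar>c\<bar> * jt_norm x" .
qed

lemma jt_norm_diff_le:
  assumes "fin_supp x" "fin_supp y"
  shows "jt_norm (\<lambda>t. x t - y t) \<le> jt_norm x + jt_norm y"
  using jt_norm_triangle[OF assms(1) fin_supp_mult[OF assms(2), of "-1"]]
    jt_norm_mult_le[OF assms(2), of "-1"] by simp

lemma jt_norm_sum_le: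
  assumes "\<And>i. i \<in> I \<Longrightarrow> fin_supp (x i)"
  shows "jt_norm (\<lambda>t. \<Sum>i\<in>I. c i * x i t) \<le> (\<Sum>i\<in>I. \<bar>c i\<bar> * jt_norm (x i))"
  using assms
proof (induction I rule: infinite_finite_induct)
  case (insert i I)
  have "jt_norm (\<lambda>t. c i * x i t + (\<Sum>i\<in>I. c i * x i t))
      \<le> jt_norm (\<lambda>t. c i * x i t) + jt_norm (\<lambda>t. \<Sum>i\<in>I. c i * x i t)"
    using insert.prems by (intro jt_norm_triangle fin_supp_sum fin_supp_mult) auto
  also have "\<dots> \<le> \<bar>c i\<bar> * jt_norm (x i) + (\<Sum>i\<in>I. \<bar>c i\<bar> * jt_norm (x i))"
    using insert by (intro add_mono jt_norm_mult_le) auto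
  finally show ?case using insert by simp
qed auto

text \<open>An interval of node numbers cuts a segment in a segment, because tree order implies
  number order. Pieces of disjoint segments coincide only when empty, so discarding the empty piece
  loses no term.\<close>

lemma seg_family_restr:
  assumes "seg_family S"
  obtains S' where "seg_family S'" "\<forall>s\<in>S'. s \<noteq> {} \<and> s \<subseteq> {a..<b}"
    "\<And>x. (\<Sum>s\<in>S'. (sum x s)\<^sup>2) = (\<Sum>s\<in>S. (sum (restr {a..<b} x) s)\<^sup>2)"
proof
  let ?A = "{a..<b}"
  let ?S = "((\<lambda>s. s \<inter> ?A) ` S) - {{}}"
  have S: "finite S" "\<And>s. s \<in> S \<Longrightarrow> finite s" "\<And>s. s \<in> S \<Longrightarrow> segment s"
    "\<And>s s'. s \<in> S \<Longrightarrow> s' \<in> S \<Longrightarrow> s \<noteq> s' \<Longrightarrow> s \<inter> s' = {}"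
    using assms by (auto simp: seg_family_def pairwise_def disjnt_def)
  show "seg_family ?S"
  proof -
    have "s \<inter> ?A \<inter> (s' \<inter> ?A) = {}" if "s \<in> S" "s' \<in> S" "s \<inter> ?A \<noteq> s' \<inter> ?A" for s s'
      using S(4)[OF that(1,2)] that(3) by blast
    then show ?thesis
      unfolding seg_family_def pairwise_def disjnt_def
      using S(1-3) by (auto simp: segment_Int_atLeastLessThan)
  qed
  show "\<forall>s\<in>?S. s \<noteq> {} \<and> s \<subseteq> ?A" by auto
  fix x :: "nat \<Rightarrow> real"
  have "(\<Sum>s\<in>?S. (sum x s)\<^sup>2) = (\<Sum>s\<in>(\<lambda>s. s \<inter> ?A) ` S. (sum x s)\<^sup>2)"
    using S(1) by (intro sum.mono_neutral_left) (auto simp del: sum.neutral_const)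
  also have "\<dots> = (\<Sum>s\<in>S. (sum x (s \<inter> ?A))\<^sup>2)"
  proof (subst sum.reindex_nontrivial)
    fix s s' assume "s \<in> S" "s' \<in> S" "s \<noteq> s'" "s \<inter> ?A = s' \<inter> ?A"
    then have "s \<inter> ?A = {}" using S(4) by blast
    then show "(sum x (s \<inter> ?A))\<^sup>2 = 0" by simp
  qed (use S in auto)
  also have "\<dots> = (\<Sum>s\<in>S. (sum (restr ?A x) s)\<^sup>2)"
    using S by (intro sum.cong refl) (simp add: restr_def sum.inter_restrict)
  finally show "(\<Sum>s\<in>?S. (sum x s)\<^sup>2) = (\<Sum>s\<in>S. (sum (restr ?A x) s)\<^sup>2)" .
qed

lemma jt_norm_restr_le:
  assumes "fin_supp x"
  shows "jt_norm (restr {a..<b} x) \<le> jt_norm x"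
proof (rule jt_norm_leI)
  fix S assume "seg_family S"
  then obtain S' where S': "seg_family S'"
    "(\<Sum>s\<in>S'. (sum x s)\<^sup>2) = (\<Sum>s\<in>S. (sum (restr {a..<b} x) s)\<^sup>2)"
    by (rule seg_family_restr[where a = a and b = b]) blast
  then show "L2_set (sum (restr {a..<b} x)) S \<le> jt_norm x"
    using seg_family_L2_le_jt_norm[OF assms S'(1)] by (simp add: L2_set_def)
qed

lemma jt_norm_restr_atLeast_le:
  assumes "fin_supp x"
  shows "jt_norm (restr {a..} x) \<le> jt_norm x"
proof -
  obtain L where L: "\<forall>t\<ge>L. x t = 0" using assms by (auto simp: fin_supp_iff)
  have "restr {a..} x = restr {a..<L} x"
    using L by (auto simp: restr_def fun_eq_iff)
  then show ?thesis using jt_norm_restr_le[OF assms] by simp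
qed

text \<open>Families cut to adjacent intervals merge into one disjoint family, whose sum of squares
  is the sum of the two.\<close>

lemma jt_norm_restr_adjacent:
  assumes "fin_supp x" "a \<le> b" "b \<le> c"
  shows "(jt_norm (restr {a..<b} x))\<^sup>2 + (jt_norm (restr {b..<c} x))\<^sup>2
      \<le> (jt_norm (restr {a..<c} x))\<^sup>2"
proof -
  let ?R = "(jt_norm (restr {a..<c} x))\<^sup>2"
  have key: "(\<Sum>s\<in>S1. (sum (restr {a..<b} x) s)\<^sup>2) + (\<Sum>s\<in>S2. (sum (restr {b..<c} x) s)\<^sup>2) \<le> ?R"
    if S: "seg_family S1" "seg_family S2" for S1 S2
  proof -
    obtain S1' where 1: "seg_family S1'" "\<forall>s\<in>S1'. s \<noteq> {} \<and> s \<subseteq> {a..<b}"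
      "\<And>x. (\<Sum>s\<in>S1'. (sum x s)\<^sup>2) = (\<Sum>s\<in>S1. (sum (restr {a..<b} x) s)\<^sup>2)"
      using seg_family_restr[OF S(1), of a b] by blast
    obtain S2' where 2: "seg_family S2'" "\<forall>s\<in>S2'. s \<noteq> {} \<and> s \<subseteq> {b..<c}"
      "\<And>x. (\<Sum>s\<in>S2'. (sum x s)\<^sup>2) = (\<Sum>s\<in>S2. (sum (restr {b..<c} x) s)\<^sup>2)"
      using seg_family_restr[OF S(2), of b c] by blast
    have dis: "s \<inter> s' = {}" if "s \<in> S1'" "s' \<in> S2'" for s s'
    proof -
      have "s \<subseteq> {a..<b}" "s' \<subseteq> {b..<c}" using that 1(2) 2(2) by auto
      then show ?thesis by fastforce
    qed
    have dis': "s' \<inter> s = {}" if "s \<in> S1'" "s' \<in> S2'" for s s'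
      using dis[OF that] by (simp add: Int_commute)
    have fam: "seg_family (S1' \<union> S2')"
      using 1(1) 2(1) dis dis'
      by (simp add: seg_family_def pairwise_def disjnt_def ball_Un)
    have "S1' \<inter> S2' = {}"
    proof (rule equals0I)
      fix s assume "s \<in> S1' \<inter> S2'"
      then show False using dis[of s s] 1(2) by auto
    qed
    then have "(\<Sum>s\<in>S1' \<union> S2'. (sum (restr {a..<c} x) s)\<^sup>2)
        = (\<Sum>s\<in>S1'. (sum (restr {a..<c} x) s)\<^sup>2) + (\<Sum>s\<in>S2'. (sum (restr {a..<c} x) s)\<^sup>2)"
      using 1(1) 2(1) by (intro sum.union_disjoint) (auto simp: seg_family_def)
    moreover have "restr {a..<b} (restr {a..<c} x) = restr {a..<b} x"
      "restr {b..<c} (restr {a..<c} x) = restr {b..<c} x"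
      using assms by (auto simp: restr_def fun_eq_iff)
    ultimately show ?thesis
      using seg_family_sum_le_jt_norm[OF fin_supp_restr[OF assms(1)] fam, of "{a..<c}"]
      by (simp add: 1(3) 2(3))
  qed
  \<comment> \<open>The two suprema are taken one after the other: over \<open>S1\<close> with
    \<open>S2\<close> fixed, then over \<open>S2\<close>.\<close>
  have 1: "(jt_norm (restr {a..<b} x))\<^sup>2 \<le> ?R - (\<Sum>s\<in>S2. (sum (restr {b..<c} x) s)\<^sup>2)"
    if "seg_family S2" for S2
    by (rule jt_norm_square_leI) (use key that assms in \<open>auto simp: algebra_simps\<close>)
  have "(jt_norm (restr {b..<c} x))\<^sup>2 \<le> ?R - (jt_norm (restr {a..<b} x))\<^sup>2"
    by (rule jt_norm_square_leI) (use 1 assms in \<open>auto simp: algebra_simps\<close>)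
  then show ?thesis by simp
qed

lemma jt_norm_restr_blocks:
  assumes "fin_supp x" "mono q"
  shows "(\<Sum>n<N. (jt_norm (restr {q n..<q (Suc n)} x))\<^sup>2) \<le> (jt_norm x)\<^sup>2"
proof -
  have "(\<Sum>n<N. (jt_norm (restr {q n..<q (Suc n)} x))\<^sup>2) \<le> (jt_norm (restr {q 0..<q N} x))\<^sup>2"
  proof (induction N)
    case (Suc N)
    then show ?case
      using jt_norm_restr_adjacent[OF assms(1), of "q 0" "q N" "q (Suc N)"] assms(2)
      by (simp add: mono_def)
  qed simp
  also have "\<dots> \<le> (jt_norm x)\<^sup>2"
    using assms(1) by (intro power_mono jt_norm_restr_le jt_norm_nonneg) auto
  finally show ?thesis .
qed

subsection \<open>Sums along ancestors\<close>

definition asum :: "nat \<Rightarrow> (nat \<Rightarrow> real) \<Rightarrow> real" where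
  "asum v x = sum x (anc v)"

lemma asum_diff: "asum v (\<lambda>t. x t - y t) = asum v x - asum v y"
  by (simp add: asum_def sum_subtractf)

lemma asum_le_jt_norm: "fin_supp x \<Longrightarrow> \<bar>asum v x\<bar> \<le> jt_norm x"
  unfolding asum_def by (simp add: segment_sum_le_jt_norm segment_anc)

lemma asum_cong_lessThan:
  assumes "anc v \<inter> {..<p} = anc w \<inter> {..<p}" "\<And>t. p \<le> t \<Longrightarrow> x t = 0"
  shows "asum v x = asum w x"
proof -
  have "asum u x = sum x (anc u \<inter> {..<p})" for u
    unfolding asum_def using assms(2) by (intro sum.mono_neutral_right) (auto simp: not_less[symmetric])
  then show ?thesis using assms(1) by simp
qed

lemma asum_eq_sum_atLeast:
  assumes "\<And>t. t < p \<Longrightarrow> x t = 0"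
  shows "asum v x = sum x (anc v \<inter> {p..})"
  unfolding asum_def using assms by (intro sum.mono_neutral_right) (auto simp: not_le)

text \<open>Two nodes with different ancestors below p have disjoint sets of ancestors above p,
  so the squares of the ancestor sums of x over different classes add up to at most the square
  of the norm of x.\<close>

lemma card_large_asum_classes:
  assumes x: "fin_supp x" "jt_norm x \<le> 1" "\<And>t. t < p \<Longrightarrow> x t = 0" and "0 < e"
  defines "F \<equiv> {anc v \<inter> {..<p} | v. e \<le> \<bar>asum v x\<bar>}"
  shows "finite F" "real (card F) * e\<^sup>2 \<le> 1"
proof -
  show fin: "finite F"
    by (rule finite_subset[of _ "Pow {..<p}"]) (auto simp: F_def)
  have "\<forall>f\<in>F. \<exists>v. f = anc v \<inter> {..<p} \<and> e \<le> \<bar>asum v x\<bar>" by (auto simp: F_def)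
  then obtain r where r: "\<And>f. f \<in> F \<Longrightarrow> f = anc (r f) \<inter> {..<p}" "\<And>f. f \<in> F \<Longrightarrow> e \<le> \<bar>asum (r f) x\<bar>"
    by metis
  define s where "s f = anc (r f) \<inter> {p..}" for f
  have dis: "s f \<inter> s g = {}" if "f \<in> F" "g \<in> F" "f \<noteq> g" for f g
  proof (rule equals0I)
    fix w assume w: "w \<in> s f \<inter> s g"
    then have "anc (r f) \<inter> {..<p} = anc w \<inter> {..<p}" "anc (r g) \<inter> {..<p} = anc w \<inter> {..<p}"
      by (auto simp: s_def intro!: anc_lessThan_eq)
    then show False using r(1) that by metis
  qed
  have eq: "sum x (s f) = asum (r f) x" for f
    unfolding s_def by (rule asum_eq_sum_atLeast[symmetric]) (rule x)
  \<comment> \<open>The sum over \<open>s f\<close> is at least \<open>e > 0\<close> in absolute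
    value. With disjointness this makes \<open>s\<close> injective, so no class is lost in the image
    family.\<close>
  have ne: "s f \<noteq> {}" if "f \<in> F" for f
    using r(2)[OF that] \<open>0 < e\<close> eq[of f] by auto
  have inj: "inj_on s F"
    using dis ne by (metis inj_onI inf.idem)
  have fam: "seg_family (s ` F)"
    unfolding seg_family_def
  proof (intro conjI)
    show "\<forall>s\<in>s ` F. finite s \<and> segment s"
      by (auto simp: s_def segment_anc_atLeast)
    show "pairwise disjnt (s ` F)"
      using dis by (auto simp: pairwise_def disjnt_def)
  qed (use fin in auto)
  have "real (card F) * e\<^sup>2 = (\<Sum>f\<in>F. e\<^sup>2)" by simp
  also have "\<dots> \<le> (\<Sum>f\<in>F. (sum x (s f))\<^sup>2)"
  proof (rule sum_mono)
    fix f assume "f \<in> F"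
    then have "e\<^sup>2 \<le> \<bar>sum x (s f)\<bar>\<^sup>2"
      unfolding eq using r(2) \<open>0 < e\<close> by (intro power_mono) auto
    then show "e\<^sup>2 \<le> (sum x (s f))\<^sup>2" by simp
  qed
  also have "\<dots> = (\<Sum>f\<in>s ` F. (sum x f)\<^sup>2)" by (simp add: sum.reindex[OF inj])
  also have "\<dots> \<le> (jt_norm x)\<^sup>2" by (rule seg_family_sum_le_jt_norm[OF x(1) fam])
  also have "\<dots> \<le> 1" using x jt_norm_nonneg by (simp add: power_le_one)
  finally show "real (card F) * e\<^sup>2 \<le> 1" .
qed

text \<open>The bound \<open>(Suc j)\<^sup>2\<close> depends on neither \<open>x\<close> nor
  \<open>p\<close>. Numbering the classes by a fixed index set lets the i-th class be followed from
  block to block, which is what compactness is applied to.\<close>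

lemma large_asum_representatives:
  assumes "fin_supp x" "jt_norm x \<le> 1" "\<And>t. t < p \<Longrightarrow> x t = 0"
  shows "\<exists>r :: nat \<Rightarrow> nat. \<forall>v. 1 / real (Suc j) \<le> \<bar>asum v x\<bar> \<longrightarrow>
           (\<exists>i<(Suc j)\<^sup>2. anc v \<inter> {..<p} = anc (r i) \<inter> {..<p})"
proof -
  define F where "F = {anc v \<inter> {..<p} | v. 1 / real (Suc j) \<le> \<bar>asum v x\<bar>}"
  have F: "finite F" "real (card F) * (1 / real (Suc j))\<^sup>2 \<le> 1"
    using card_large_asum_classes[OF assms, where e = "1 / real (Suc j)"] by (simp_all add: F_def)
  have "real (card F) \<le> real ((Suc j)\<^sup>2)"
    using F(2) by (simp add: power_divide divide_simps del: of_nat_Suc)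
  then have card: "card F \<le> (Suc j)\<^sup>2" by (simp only: of_nat_le_iff)
  obtain h where h: "bij_betw h {..<card F} F"
    using ex_bij_betw_nat_finite[OF F(1)] by (auto simp: atLeast0LessThan)
  \<comment> \<open>For \<open>i \<ge> card F\<close> the value is arbitrary; such indices only add
    harmless candidates.\<close>
  define r where "r i = (SOME v. h i = anc v \<inter> {..<p})" for i
  have r: "h i = anc (r i) \<inter> {..<p}" if "i < card F" for i
  proof -
    have "h i \<in> F" using h that by (auto simp: bij_betw_def)
    then have "\<exists>v. h i = anc v \<inter> {..<p}" by (auto simp: F_def)
    then show ?thesis unfolding r_def by (rule someI_ex)
  qed
  have "\<exists>i<(Suc j)\<^sup>2. anc v \<inter> {..<p} = anc (r i) \<inter> {..<p}" if "1 / real (Suc j) \<le> \<bar>asum v x\<bar>" for v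
  proof -
    have "anc v \<inter> {..<p} \<in> h ` {..<card F}"
      using h that by (auto simp: bij_betw_def F_def)
    then show ?thesis using r card by (auto intro: less_le_trans)
  qed
  then show ?thesis by blast
qed

lemma diagonal_convergent_subsequence:
  fixes f :: "nat \<Rightarrow> 'i::countable \<Rightarrow> real"
  assumes "\<And>k. bounded (range (\<lambda>n. f n k))"
  obtains r :: "nat \<Rightarrow> nat" where "strict_mono r" "\<And>k. convergent (\<lambda>n. f (r n) k)"
proof -
  interpret subseqs "\<lambda>k s. convergent (\<lambda>n. f (s n) (from_nat k))"
  proof
    fix k :: nat and s :: "nat \<Rightarrow> nat"
    have "bounded (range (\<lambda>n. f (s n) (from_nat k)))"
      using assms[of "from_nat k"] by (rule bounded_subset) auto
    then obtain l and r' :: "nat \<Rightarrow> nat" where "strict_mono r'" "((\<lambda>n. f (s n) (from_nat k)) \<circ> r') \<longlonglongrightarrow> l"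
      using bounded_imp_convergent_subsequence by blast
    then show "\<exists>r'. strict_mono r' \<and> convergent (\<lambda>n. f ((s \<circ> r') n) (from_nat k))"
      by (auto simp: convergent_def o_def)
  qed
  have "convergent (\<lambda>n. f (diagseq n) k)" for k
  proof -
    \<comment> \<open>The diagonal sequence is a subsequence of the one chosen for coordinate
      \<open>k\<close> only after an initial piece, whence the shift.\<close>
    have "convergent (\<lambda>n. f ((diagseq \<circ> ((+) (Suc (to_nat k)))) n) (from_nat (to_nat k)))"
    proof (rule diagseq_holds)
      fix r s :: "nat \<Rightarrow> nat" and n :: nat
      assume "strict_mono r" "convergent (\<lambda>n'. f (s n') (from_nat n))"
      then show "convergent (\<lambda>n'. f ((s \<circ> r) n') (from_nat n))"
        using convergent_subseq_convergent[of "\<lambda>n'. f (s n') (from_nat n)" r] by (simp add: o_def)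
    qed
    then have "convergent (\<lambda>n. f (diagseq (n + Suc (to_nat k))) k)"
      by (simp add: add.commute)
    then show ?thesis by (subst (asm) convergent_ignore_initial_segment)
  qed
  with subseq_diagseq show ?thesis using that by blast
qed

subsection \<open>Differences of block sequences\<close>

text \<open>No path carries two terms of size \<open>e\<close> once \<open>n\<close> is large and
  \<open>m\<close> is large depending on \<open>n\<close>. The quantifiers are iterated because the
  classes of later terms settle, as seen by \<open>y n\<close>, only after \<open>n\<close> is
  fixed.\<close>

definition branch_null :: "(nat \<Rightarrow> nat \<Rightarrow> real) \<Rightarrow> bool" where
  "branch_null y \<longleftrightarrow> (\<forall>e>0. \<forall>\<^sub>F n in sequentially. \<forall>\<^sub>F m in sequentially.
     \<forall>v. e \<le> \<bar>asum v (y m)\<bar> \<longrightarrow> \<bar>asum v (y n)\<bar> < e)"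

lemma branch_null_differences:
  fixes x :: "nat \<Rightarrow> nat \<Rightarrow> real"
  assumes fin: "\<And>n. fin_supp (x n)" and le1: "\<And>n. jt_norm (x n) \<le> 1"
    and p: "strict_mono p" and supp: "\<And>n t. x n t \<noteq> 0 \<Longrightarrow> p n \<le> t \<and> t < p (Suc n)"
  obtains r :: "nat \<Rightarrow> nat" where "strict_mono r"
    "branch_null (\<lambda>n t. x (r (Suc (2 * n))) t - x (r (2 * n)) t)"
proof -
  have "\<forall>n j. \<exists>w :: nat \<Rightarrow> nat. \<forall>v. 1 / real (Suc j) \<le> \<bar>asum v (x n)\<bar> \<longrightarrow>
           (\<exists>i<(Suc j)\<^sup>2. anc v \<inter> {..<p n} = anc (w i) \<inter> {..<p n})"
    using supp by (intro allI large_asum_representatives fin le1) (meson leD)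
  then obtain w :: "nat \<Rightarrow> nat \<Rightarrow> nat \<Rightarrow> nat" where w: "\<And>n j v. 1 / real (Suc j) \<le> \<bar>asum v (x n)\<bar> \<Longrightarrow>
           \<exists>i<(Suc j)\<^sup>2. anc v \<inter> {..<p n} = anc (w n j i) \<inter> {..<p n}"
    by metis
  have bd: "\<bar>asum v (x n)\<bar> \<le> 1" for v n
    using asum_le_jt_norm[OF fin[of n], of v] le1[of n] by linarith
  \<comment> \<open>First compactness: the sums of a fixed block \<open>x n\<close> along the i-th
    representative of block m converge in m. The limit \<open>L n j i\<close> plays the part of the
    sum of \<open>x n\<close> along a limit branch.\<close>
  obtain r1 :: "nat \<Rightarrow> nat" where r1: "strict_mono r1"
    "\<And>k. convergent (\<lambda>m. case k of (n, j, i) \<Rightarrow> asum (w (r1 m) j i) (x n))"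
  proof (rule diagonal_convergent_subsequence[of "\<lambda>m (n, j, i). asum (w m j i) (x n)"])
    show "bounded (range (\<lambda>m. case k of (n, j, i) \<Rightarrow> asum (w m j i) (x n)))" for k
      by (rule boundedI[of _ 1]) (auto simp: bd split: prod.splits)
  qed blast
  define L where "L n j i = lim (\<lambda>m. asum (w (r1 m) j i) (x n))" for n j i
  have L: "(\<lambda>m. asum (w (r1 m) j i) (x n)) \<longlonglongrightarrow> L n j i" for n j i
    using r1(2)[of "(n, j, i)"] by (simp add: L_def convergent_LIMSEQ_iff)
  have Lbd: "\<bar>L n j i\<bar> \<le> 1" for n j i
    by (rule LIMSEQ_le_const2[OF tendsto_rabs[OF L]]) (simp add: bd)
  \<comment> \<open>Second compactness: these limits converge from block to block, so two terms far
    out have nearly equal limits and \<open>D\<close> tends to 0.\<close>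
  obtain r2 :: "nat \<Rightarrow> nat" where r2: "strict_mono r2"
    "\<And>k. convergent (\<lambda>n. case k of (j, i) \<Rightarrow> L (r1 (r2 n)) j i)"
  proof (rule diagonal_convergent_subsequence[of "\<lambda>n (j, i). L (r1 n) j i"])
    show "bounded (range (\<lambda>n. case k of (j, i) \<Rightarrow> L (r1 n) j i))" for k
      by (rule boundedI[of _ 1]) (auto simp: Lbd split: prod.splits)
  qed blast
  define r where "r = r1 \<circ> r2"
  have r: "strict_mono r" unfolding r_def by (rule strict_mono_o[OF r1(1) r2(1)])
  define y where "y n t = x (r (Suc (2 * n))) t - x (r (2 * n)) t" for n t
  define D where "D n j i = L (r (Suc (2 * n))) j i - L (r (2 * n)) j i" for n j i
  have odd: "strict_mono (\<lambda>n. Suc (2 * n))" and even: "strict_mono (\<lambda>n::nat. 2 * n)"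
    by (simp_all add: strict_mono_def)
  have D: "(\<lambda>n. D n j i) \<longlonglongrightarrow> 0" for j i
  proof -
    obtain l where l: "(\<lambda>n. L (r n) j i) \<longlonglongrightarrow> l"
      using r2(2)[of "(j, i)"] by (auto simp: convergent_def r_def)
    show ?thesis
      using tendsto_diff[OF LIMSEQ_subseq_LIMSEQ[OF l odd] LIMSEQ_subseq_LIMSEQ[OF l even]]
      by (simp add: D_def o_def)
  qed
  have lim_y: "(\<lambda>m. asum (w (r m) j i) (y n)) \<longlonglongrightarrow> D n j i" for n j i
  proof -
    have "(\<lambda>m. asum (w (r m) j i) (x n')) \<longlonglongrightarrow> L n' j i" for n'
      using LIMSEQ_subseq_LIMSEQ[OF L r2(1), of j i n'] by (simp add: o_def r_def)
    then show ?thesis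
      unfolding D_def y_def asum_diff by (intro tendsto_diff)
  qed
  have "branch_null y"
    unfolding branch_null_def
  proof (intro allI impI)
    fix e :: real assume "0 < e"
    \<comment> \<open>If a difference has size \<open>e\<close>, one of its two terms has size
      \<open>e / 2\<close>; this fixes the level \<open>j\<close> of the classes.\<close>
    then obtain j where "inverse (real (Suc j)) < e / 2" using reals_Archimedean[of "e / 2"] by auto
    then have j: "1 / real (Suc j) \<le> e / 2" by (simp add: inverse_eq_divide)
    have "\<forall>\<^sub>F n in sequentially. \<forall>i\<in>{..<(Suc j)\<^sup>2}. \<bar>D n j i\<bar> < e / 2"
      using \<open>0 < e\<close> tendstoD[OF D, of "e / 2"] by (intro eventually_ball_finite) auto
    then show "\<forall>\<^sub>F n in sequentially. \<forall>\<^sub>F m in sequentially.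
        \<forall>v. e \<le> \<bar>asum v (y m)\<bar> \<longrightarrow> \<bar>asum v (y n)\<bar> < e"
    proof (eventually_elim)
      fix n assume n: "\<forall>i\<in>{..<(Suc j)\<^sup>2}. \<bar>D n j i\<bar> < e / 2"
      have "\<forall>\<^sub>F m in sequentially. \<forall>i\<in>{..<(Suc j)\<^sup>2}. \<bar>asum (w (r m) j i) (y n)\<bar> < e"
      proof (intro eventually_ball_finite ballI)
        fix i assume "i \<in> {..<(Suc j)\<^sup>2}"
        then have "\<bar>D n j i\<bar> < e" using n \<open>0 < e\<close> by force
        then show "\<forall>\<^sub>F m in sequentially. \<bar>asum (w (r m) j i) (y n)\<bar> < e"
          by (rule order_tendstoD(2)[OF tendsto_rabs[OF lim_y]])
      qed simp
      then obtain N where N: "\<And>m i. N \<le> m \<Longrightarrow> i < (Suc j)\<^sup>2 \<Longrightarrow> \<bar>asum (w (r m) j i) (y n)\<bar> < e"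
        by (auto simp: eventually_sequentially)
      show "\<forall>\<^sub>F m in sequentially. \<forall>v. e \<le> \<bar>asum v (y m)\<bar> \<longrightarrow> \<bar>asum v (y n)\<bar> < e"
        unfolding eventually_sequentially
      \<comment> \<open>\<open>m > n\<close> puts the support of \<open>y n\<close> below
        \<open>p (r k)\<close>, where \<open>x (r k)\<close> is the large term of
        \<open>y m\<close>. There the class of \<open>v\<close> alone determines
        \<open>asum v (y n)\<close>, so \<open>v\<close> may be exchanged for a
        representative.\<close>
      proof (intro exI[of _ "max N (Suc n)"] allI impI)
        fix m v assume m: "max N (Suc n) \<le> m" and big: "e \<le> \<bar>asum v (y m)\<bar>"
        have "asum v (y m) = asum v (x (r (Suc (2 * m)))) - asum v (x (r (2 * m)))"
          by (simp add: y_def[abs_def] asum_diff)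
        then have "e / 2 \<le> \<bar>asum v (x (r (Suc (2 * m))))\<bar> \<or> e / 2 \<le> \<bar>asum v (x (r (2 * m)))\<bar>"
          using big by linarith
        then obtain k where k: "k \<in> {2 * m, Suc (2 * m)}" "e / 2 \<le> \<bar>asum v (x (r k))\<bar>" by blast
        then obtain i where i: "i < (Suc j)\<^sup>2" "anc v \<inter> {..<p (r k)} = anc (w (r k) j i) \<inter> {..<p (r k)}"
          using w[of j v "r k"] j by auto
        have "y n t = 0" if "p (r k) \<le> t" for t
        proof -
          have "Suc (r (Suc (2 * n))) \<le> r k" "Suc (r (2 * n)) \<le> r k"
            using r m k(1) by (auto simp: Suc_le_eq strict_mono_less)
          then have "p (Suc (r (Suc (2 * n)))) \<le> t" "p (Suc (r (2 * n))) \<le> t"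
            using p that by (meson le_trans strict_mono_less_eq)+
          then show ?thesis unfolding y_def using supp by (metis diff_self leD)
        qed
        then have "asum v (y n) = asum (w (r k) j i) (y n)"
          by (rule asum_cong_lessThan[OF i(2)])
        then show "\<bar>asum v (y n)\<bar> < e" using N[of k i] i(1) k(1) m by auto
      qed
    qed
  qed
  then show ?thesis using that[OF r] by (simp add: y_def[abs_def])
qed

text \<open>A term is compared with the threshold of its predecessor: \<open>branch_null\<close>
  supplies good indices only for a given \<open>e\<close>, so the threshold must be known before the
  term is chosen.\<close>

lemma branch_null_fast_subsequence:
  fixes e :: "nat \<Rightarrow> real"
  assumes "branch_null y" "\<And>n. 0 < e n"
  obtains s :: "nat \<Rightarrow> nat" where "strict_mono s"
    "\<And>n m v. n < m \<Longrightarrow> e (s n) \<le> \<bar>asum v (y (s (Suc m)))\<bar> \<Longrightarrow> \<bar>asum v (y (s (Suc n)))\<bar> < e (s n)"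
proof -
  define G where "G a n m \<longleftrightarrow> (\<forall>v. e a \<le> \<bar>asum v (y m)\<bar> \<longrightarrow> \<bar>asum v (y n)\<bar> < e a)" for a n m
  define E where "E a n \<longleftrightarrow> (\<forall>\<^sub>F m in sequentially. G a n m)" for a n
  \<comment> \<open>\<open>N\<close> is good for the threshold \<open>e a\<close> and meets every
    demand that good indices up to \<open>a\<close> make on later terms. Ranging over all
    \<open>b\<close> and \<open>c\<close> up to \<open>a\<close> covers the whole history, so each
    choice depends on the last term only.\<close>
  define R where "R a N \<longleftrightarrow> a < N \<and> E a N \<and> (\<forall>b\<in>{..a}. \<forall>c\<in>{..a}. E b c \<longrightarrow> G b c N)" for a N
  have "\<exists>N. R a N" for a
  proof -
    have "\<forall>\<^sub>F N in sequentially. E a N"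
      using assms unfolding branch_null_def E_def G_def by blast
    moreover have "\<forall>\<^sub>F N in sequentially. a < N" by (rule eventually_gt_at_top)
    moreover have "\<forall>\<^sub>F N in sequentially. \<forall>b\<in>{..a}. \<forall>c\<in>{..a}. E b c \<longrightarrow> G b c N"
      by (intro eventually_ball_finite ballI finite_atMost) (auto simp: E_def)
    ultimately have "\<forall>\<^sub>F N in sequentially. R a N"
      unfolding R_def by eventually_elim blast
    then show ?thesis by (auto simp: eventually_sequentially)
  qed
  then obtain s where s: "\<And>n. R (s n) (s (Suc n))"
    using dependent_nat_choice[of "\<lambda>_ _. True" "\<lambda>_. R"] by auto
  have mono: "strict_mono s"
    using s by (auto simp: R_def strict_mono_Suc_iff)
  have "G (s n) (s (Suc n)) (s (Suc m))" if "n < m" for n m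
  proof -
    have "s n \<le> s m" "s (Suc n) \<le> s m"
      using mono that by (simp_all add: strict_mono_less_eq)
    then show ?thesis using s[of n] s[of m] by (auto simp: R_def)
  qed
  then show ?thesis using that[OF mono] unfolding G_def by blast
qed

text \<open>Backward induction on \<open>k\<close>. If \<open>b (Suc k)\<close> is large on its
  scale \<open>e k\<close>, then \<open>drop\<close> puts every later term below \<open>e k\<close>:
  the former exception is absorbed at that price and \<open>Suc k\<close> becomes the new
  one.\<close>

lemma sum_except_one_le:
  fixes b e :: "nat \<Rightarrow> real"
  assumes b: "\<And>n. 0 \<le> b n" and e: "\<And>n. 0 \<le> e n"
    and drop: "\<And>n m. n < m \<Longrightarrow> e n \<le> b (Suc m) \<Longrightarrow> b (Suc n) < e n"
  shows "\<exists>h. sum b ({Suc k..<N} - {h}) \<le> 2 * sum e {k..<N}"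
proof (cases "k \<le> N")
  case False
  then show ?thesis using e by (auto intro!: sum_nonneg)
next
  case True
  then show ?thesis
  proof (induction k rule: inc_induct)
    case base
    show ?case by simp
  next
    case (step k)
    let ?A = "{Suc (Suc k)..<N}"
    obtain h where h: "sum b (?A - {h}) \<le> 2 * sum e {Suc k..<N}" using step.IH by blast
    have e_split: "sum e {k..<N} = e k + sum e {Suc k..<N}"
      using step.hyps by (simp add: sum.atLeast_Suc_lessThan)
    show ?case
    proof (cases "b (Suc k) < e k")
      case True
      have "sum b ({Suc k..<N} - {h}) \<le> sum b (insert (Suc k) (?A - {h}))"
        using b by (intro sum_mono2) auto
      also have "\<dots> = b (Suc k) + sum b (?A - {h})" by (subst sum.insert) auto
      finally show ?thesis using h True e_split e[of k] by (intro exI[of _ h]) simp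
    next
      case False
      have "sum b ?A \<le> sum b (?A - {h}) + e k"
      proof (cases "h \<in> ?A")
        case True
        then obtain m where m: "h = Suc m" "k < m" by (cases h) auto
        then have "b h < e k" using drop[of k m] False by force
        then show ?thesis using True by (subst sum.remove[of _ h]) auto
      qed (use e in auto)
      moreover have "{Suc k..<N} - {Suc k} = ?A" by auto
      ultimately show ?thesis using h e_split e[of k] by (intro exI[of _ "Suc k"]) simp
    qed
  qed
qed

lemma sum_half_power_le:
  fixes hi :: "nat \<Rightarrow> nat"
  assumes "strict_mono hi"
  shows "(\<Sum>n=k..<N. (1/2 :: real) ^ hi n) \<le> 2 * (1/2) ^ hi k"
proof (cases "k \<le> N")
  case True
  then show ?thesis
  proof (induction k rule: inc_induct)
    case (step k)
    have "Suc (hi k) \<le> hi (Suc k)" using assms by (simp add: strict_mono_Suc_iff Suc_le_eq)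
    then have "(1/2 :: real) ^ hi (Suc k) \<le> (1/2) ^ Suc (hi k)" by (intro power_decreasing) auto
    then show ?case using step by (simp add: sum.atLeast_Suc_lessThan)
  qed simp
qed simp

text \<open>A segment starting in block k sees the later blocks only through the ancestor sums of its
  last node. All of these but one are small, and the exceptional one is paid for by the
  contribution of its own block.\<close>

lemma segment_square_estimate:
  fixes z :: "nat \<Rightarrow> nat \<Rightarrow> real"
  assumes supp: "\<And>n t. z n t \<noteq> 0 \<Longrightarrow> lo n \<le> t \<and> t < hi n"
    and blocks: "\<And>n. lo n < hi n" "\<And>n. hi n \<le> lo (Suc n)"
    and drop: "\<And>n m v. n < m \<Longrightarrow> (1/2) ^ hi n \<le> \<bar>asum v (z (Suc m))\<bar> \<Longrightarrow> \<bar>asum v (z (Suc n))\<bar> < (1/2) ^ hi n"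
    and s: "segment s" "finite s" "s \<noteq> {}"
  shows "(\<Sum>t\<in>s. \<Sum>n<N. c n * z n t)\<^sup>2
    \<le> 3 * (\<Sum>n<N. (c n)\<^sup>2 * (sum (z n) s)\<^sup>2) + 12 * (\<Sum>n<N. (c n)\<^sup>2) * (1/4) ^ Min s"
proof -
  define u v where "u = Min s" and "v = Max s"
  have s_eq: "s = anc v \<inter> {u..}" unfolding u_def v_def by (rule segment_eq_anc[OF s])
  have hi: "strict_mono hi"
    unfolding strict_mono_Suc_iff using blocks by (meson le_less_trans)
  \<comment> \<open>Blocks before \<open>k\<close> miss \<open>s\<close>, block \<open>k\<close> may
    be entered midway, and blocks after it start beyond \<open>u\<close>.\<close>
  define k where "k = (LEAST m. u < hi m)"
  have "u < hi (Suc u)" using seq_suble[OF hi, of "Suc u"] by simp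
  then have k: "u < hi k" and k_least: "\<And>m. m < k \<Longrightarrow> hi m \<le> u"
    unfolding k_def by (auto intro: LeastI dest: not_less_Least simp: not_less[symmetric])
  define \<sigma> where "\<sigma> n = sum (z n) s" for n
  have before: "\<sigma> n = 0" if "n < k" for n
    unfolding \<sigma>_def
  proof (rule sum.neutral, rule ballI)
    fix t assume "t \<in> s"
    then have "hi n \<le> t" using k_least[OF that] by (auto simp: s_eq)
    then show "z n t = 0" using supp[of n t] by force
  qed
  have after: "\<sigma> n = asum v (z n)" if "k < n" for n
  proof -
    have "hi k \<le> lo n"
    proof -
      obtain n' where n': "n = Suc n'" "k \<le> n'" using \<open>k < n\<close> by (cases n) auto
      then have "hi k \<le> hi n'" using hi by (simp add: strict_mono_less_eq)
      then show ?thesis using blocks(2)[of n'] n' by simp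
    qed
    then have "asum v (z n) = sum (z n) (anc v \<inter> {u..})"
      using supp[of n] k by (intro asum_eq_sum_atLeast) force
    then show ?thesis by (simp add: \<sigma>_def s_eq)
  qed
  obtain h where h: "(\<Sum>n\<in>{Suc k..<N} - {h}. \<bar>asum v (z n)\<bar>) \<le> 2 * (\<Sum>n=k..<N. (1/2) ^ hi n)"
    using sum_except_one_le[of "\<lambda>n. \<bar>asum v (z n)\<bar>" "\<lambda>n. (1/2) ^ hi n" k N] drop by auto
  \<comment> \<open>\<open>I\<close> holds the two sums that need not be small: that of block
    \<open>k\<close> and that of the exception \<open>h\<close>, which may lie outside the
    range.\<close>
  define I R where "I = {..<N} \<inter> {k, h}" and "R = {Suc k..<N} - {h}"
  define K where "K = L2_set c {..<N}"
  have K: "K\<^sup>2 = (\<Sum>n<N. (c n)\<^sup>2)" "0 \<le> K"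
    by (simp_all add: K_def L2_set_def sum_nonneg)
  have c_le: "\<bar>c n\<bar> \<le> K" if "n < N" for n
    using member_le_L2_set[of "{..<N}" n "\<lambda>n. \<bar>c n\<bar>"] that by (simp add: K_def L2_set_def)
  have "(\<Sum>t\<in>s. \<Sum>n<N. c n * z n t) = (\<Sum>n<N. c n * \<sigma> n)"
    by (subst sum.swap) (simp add: \<sigma>_def sum_distrib_left)
  also have "\<dots> = (\<Sum>n\<in>I. c n * \<sigma> n) + (\<Sum>n\<in>{..<N} - I. c n * \<sigma> n)"
    by (subst sum.subset_diff[of I]) (auto simp: I_def)
  also have "(\<Sum>n\<in>{..<N} - I. c n * \<sigma> n) = (\<Sum>n\<in>R. c n * \<sigma> n)"
    using before by (intro sum.mono_neutral_right) (auto simp: I_def R_def not_less_eq_eq)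
  finally have split: "(\<Sum>t\<in>s. \<Sum>n<N. c n * z n t) = (\<Sum>n\<in>I. c n * \<sigma> n) + (\<Sum>n\<in>R. c n * \<sigma> n)" .
  have "\<bar>\<Sum>n\<in>R. c n * \<sigma> n\<bar> \<le> (\<Sum>n\<in>R. K * \<bar>asum v (z n)\<bar>)"
  proof (intro order_trans[OF sum_abs] sum_mono)
    fix n assume "n \<in> R"
    then show "\<bar>c n * \<sigma> n\<bar> \<le> K * \<bar>asum v (z n)\<bar>"
      using c_le[of n] after[of n] by (auto simp: R_def abs_mult intro!: mult_right_mono)
  qed
  also have "\<dots> \<le> K * (2 * (2 * (1/2) ^ hi k))"
    unfolding sum_distrib_left[symmetric] R_def
    using h sum_half_power_le[OF hi, of k N] K(2) by (intro mult_left_mono) linarith+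
  also have "\<dots> \<le> K * (2 * (1/2) ^ u)"
  proof -
    \<comment> \<open>\<open>u < hi k\<close> trades the scale of the block for the starting node of
      the segment.\<close>
    have "(1/2 :: real) ^ hi k \<le> (1/2) ^ Suc u" using k by (intro power_decreasing) auto
    then show ?thesis using K(2) by (intro mult_left_mono) auto
  qed
  finally have "\<bar>\<Sum>n\<in>R. c n * \<sigma> n\<bar>\<^sup>2 \<le> (K * (2 * (1/2) ^ u))\<^sup>2" by (intro power_mono) auto
  then have R: "(\<Sum>n\<in>R. c n * \<sigma> n)\<^sup>2 \<le> 4 * K\<^sup>2 * (1/4) ^ u"
    using power_mult[of "1/2 :: real" u 2] power_mult[of "1/2 :: real" 2 u]
    by (simp add: power_mult_distrib mult.commute power_divide)
  have "(\<Sum>n\<in>I. c n * \<sigma> n)\<^sup>2 \<le> (\<Sum>n\<in>I. (c n * \<sigma> n)\<^sup>2) * card I"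
    by (rule sum_squared_le_sum_of_squares) 
  also have "\<dots> \<le> (\<Sum>n\<in>I. (c n * \<sigma> n)\<^sup>2) * 2"
  proof (rule mult_left_mono)
    have "card I \<le> card {k, h}" unfolding I_def by (rule card_mono) auto
    also have "\<dots> \<le> 2" by (simp add: card_insert_if)
    finally show "real (card I) \<le> 2" by simp
  qed (simp add: sum_nonneg)
  also have "(\<Sum>n\<in>I. (c n * \<sigma> n)\<^sup>2) \<le> (\<Sum>n<N. (c n)\<^sup>2 * (\<sigma> n)\<^sup>2)"
    unfolding power_mult_distrib by (rule sum_mono2) (auto simp: I_def)
  finally have I: "(\<Sum>n\<in>I. c n * \<sigma> n)\<^sup>2 \<le> 2 * (\<Sum>n<N. (c n)\<^sup>2 * (\<sigma> n)\<^sup>2)" by simp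
  \<comment> \<open>The weights produce the constants of the statement: 3/2 times the 2 from
    \<open>card I\<close> is 3, and 3 times the 4 from \<open>R\<close> is 12.\<close>
  have young: "(a + r)\<^sup>2 \<le> 3/2 * a\<^sup>2 + 3 * r\<^sup>2" for a r :: real
    using zero_le_power2[of "a - 2 * r"] by (simp add: power2_eq_square algebra_simps)
  show ?thesis
    unfolding split using young[of "\<Sum>n\<in>I. c n * \<sigma> n" "\<Sum>n\<in>R. c n * \<sigma> n"] I R
    by (simp add: K(1) \<sigma>_def u_def)
qed

text \<open>Sum the segment estimate over the family. Within one block the squares of the segment
  sums add up to at most \<open>C\<^sup>2\<close>; the error weights have distinct exponents and add
  up to at most 4/3, and 12 times 4/3 is 16.\<close>

lemma jt_upper_2_estimate:
  fixes z :: "nat \<Rightarrow> nat \<Rightarrow> real"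
  assumes fin: "\<And>n. fin_supp (z n)" and le: "\<And>n. jt_norm (z n) \<le> C"
    and supp: "\<And>n t. z n t \<noteq> 0 \<Longrightarrow> lo n \<le> t \<and> t < hi n"
    and blocks: "\<And>n. lo n < hi n" "\<And>n. hi n \<le> lo (Suc n)"
    and drop: "\<And>n m v. n < m \<Longrightarrow> (1/2) ^ hi n \<le> \<bar>asum v (z (Suc m))\<bar> \<Longrightarrow> \<bar>asum v (z (Suc n))\<bar> < (1/2) ^ hi n"
  shows "jt_norm (\<lambda>t. \<Sum>n<N. c n * z n t) \<le> sqrt (3 * C\<^sup>2 + 16) * L2_set c {..<N}"
proof (rule jt_norm_leI)
  fix S assume S: "seg_family S"
  let ?Z = "\<lambda>t. \<Sum>n<N. c n * z n t"
  let ?S = "S - {{}}"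
  let ?K = "\<Sum>n<N. (c n)\<^sup>2"
  have finS: "finite S" using S by (simp add: seg_family_def)
  have first: "(\<Sum>s\<in>?S. \<Sum>n<N. (c n)\<^sup>2 * (sum (z n) s)\<^sup>2) \<le> C\<^sup>2 * ?K"
  proof -
    have "(\<Sum>s\<in>?S. \<Sum>n<N. (c n)\<^sup>2 * (sum (z n) s)\<^sup>2) = (\<Sum>n<N. (c n)\<^sup>2 * (\<Sum>s\<in>?S. (sum (z n) s)\<^sup>2))"
      by (subst sum.swap) (simp add: sum_distrib_left)
    also have "\<dots> \<le> (\<Sum>n<N. (c n)\<^sup>2 * C\<^sup>2)"
    proof (intro sum_mono mult_left_mono)
      fix n
      have "(\<Sum>s\<in>?S. (sum (z n) s)\<^sup>2) \<le> (\<Sum>s\<in>S. (sum (z n) s)\<^sup>2)"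
        using finS by (intro sum_mono2) auto
      also have "\<dots> \<le> (jt_norm (z n))\<^sup>2" by (rule seg_family_sum_le_jt_norm[OF fin S])
      also have "\<dots> \<le> C\<^sup>2" by (intro power_mono le jt_norm_nonneg fin)
      finally show "(\<Sum>s\<in>?S. (sum (z n) s)\<^sup>2) \<le> C\<^sup>2" .
    qed simp
    finally show ?thesis by (simp add: sum_distrib_left mult.commute)
  qed
  have second: "(\<Sum>s\<in>?S. (1/4 :: real) ^ Min s) \<le> 4 / 3"
  proof -
    have inj: "inj_on Min ?S"
    proof (rule inj_onI)
      fix s s' assume a: "s \<in> ?S" "s' \<in> ?S" "Min s = Min s'"
      then have "finite s" "finite s'" using S by (auto simp: seg_family_def)
      then have "Min s \<in> s" "Min s \<in> s'" using a Min_in[of s] Min_in[of s'] by auto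
      moreover have "s = s' \<or> s \<inter> s' = {}"
        using a(1,2) S unfolding seg_family_def pairwise_def disjnt_def by (meson DiffD1)
      ultimately show "s = s'" by blast
    qed
    have "(\<Sum>s\<in>?S. (1/4 :: real) ^ Min s) = (\<Sum>u\<in>Min ` ?S. (1/4) ^ u)"
      by (simp add: sum.reindex[OF inj])
    also have "\<dots> \<le> (\<Sum>u. (1/4 :: real) ^ u)"
      using finS by (intro sum_le_suminf summable_geometric) auto
    also have "\<dots> = 4 / 3" by (subst suminf_geometric) auto
    finally show ?thesis .
  qed
  have "(\<Sum>s\<in>S. (sum ?Z s)\<^sup>2) = (\<Sum>s\<in>?S. (sum ?Z s)\<^sup>2)"
    using finS by (intro sum.mono_neutral_right) auto
  also have "\<dots> \<le> (\<Sum>s\<in>?S. 3 * (\<Sum>n<N. (c n)\<^sup>2 * (sum (z n) s)\<^sup>2) + 12 * ?K * (1/4) ^ Min s)"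
    using S
    by (intro sum_mono segment_square_estimate[where lo = lo and hi = hi] supp blocks drop)
      (auto simp: seg_family_def)
  also have "\<dots> = 3 * (\<Sum>s\<in>?S. \<Sum>n<N. (c n)\<^sup>2 * (sum (z n) s)\<^sup>2) + 12 * ?K * (\<Sum>s\<in>?S. (1/4) ^ Min s)"
    by (simp add: sum.distrib sum_distrib_left)
  also have "\<dots> \<le> 3 * (C\<^sup>2 * ?K) + 12 * ?K * (4 / 3)"
    using first second by (intro add_mono mult_left_mono) (auto simp: sum_nonneg)
  also have "\<dots> = (3 * C\<^sup>2 + 16) * ?K" by (simp add: algebra_simps)
  finally show "L2_set (sum ?Z) S \<le> sqrt (3 * C\<^sup>2 + 16) * L2_set c {..<N}"
    unfolding L2_set_def real_sqrt_mult[symmetric] by (rule real_sqrt_le_mono)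
qed

subsection \<open>The duality between B and the finitely supported vectors\<close>

definition pairing :: "(nat \<Rightarrow> real) \<Rightarrow> (nat \<Rightarrow> real) \<Rightarrow> real" where
  "pairing a x = (\<Sum>t | x t \<noteq> 0. a t * x t)"

lemma pairing_eq_sum_lessThan:
  assumes "\<And>t. L \<le> t \<Longrightarrow> x t = 0"
  shows "pairing a x = (\<Sum>t<L. a t * x t)"
proof -
  have "t < L" if "x t \<noteq> 0" for t using assms[of t] that by (cases "t < L") auto
  then show ?thesis unfolding pairing_def by (intro sum.mono_neutral_left) auto
qed

lemma pairing_add:
  assumes "fin_supp x" "fin_supp y"
  shows "pairing a (\<lambda>t. x t + y t) = pairing a x + pairing a y"
proof -
  obtain K L where "\<forall>t\<ge>K. x t = 0" "\<forall>t\<ge>L. y t = 0" using assms by (auto simp: fin_supp_iff)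
  then show ?thesis
    by (simp add: pairing_eq_sum_lessThan[where L = "max K L"] sum.distrib[symmetric] distrib_left)
qed

lemma pairing_zero [simp]: "pairing a (\<lambda>t. 0) = 0"
  by (simp add: pairing_def)

lemma pairing_mult: "pairing a (\<lambda>t. c * x t) = c * pairing a x"
  by (cases "c = 0") (auto simp: pairing_def sum_distrib_left algebra_simps)

lemma pairing_diff:
  assumes "fin_supp x" "fin_supp y"
  shows "pairing a (\<lambda>t. x t - y t) = pairing a x - pairing a y"
  using pairing_add[OF assms(1) fin_supp_mult[OF assms(2), of "-1"]] pairing_mult[of a "-1" y] by simp

lemma pairing_sum:
  assumes "\<And>i. i \<in> I \<Longrightarrow> fin_supp (x i)"
  shows "pairing a (\<lambda>t. \<Sum>i\<in>I. c i * x i t) = (\<Sum>i\<in>I. c i * pairing a (x i))"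
  using assms
proof (induction I rule: infinite_finite_induct)
  case (insert i I)
  have "pairing a (\<lambda>t. c i * x i t + (\<Sum>i\<in>I. c i * x i t))
      = pairing a (\<lambda>t. c i * x i t) + pairing a (\<lambda>t. \<Sum>i\<in>I. c i * x i t)"
    using insert.prems by (intro pairing_add fin_supp_sum fin_supp_mult) auto
  then show ?case using insert by (simp add: pairing_mult)
qed auto

lemma pairing_add_left: "pairing (\<lambda>t. a t + b t) x = pairing a x + pairing b x"
  by (simp add: pairing_def sum.distrib distrib_right)

lemma pairing_diff_left: "pairing (\<lambda>t. a t - b t) x = pairing a x - pairing b x"
  by (simp add: pairing_def sum_subtractf left_diff_distrib)

lemma pairing_mult_left: "pairing (\<lambda>t. c * a t) x = c * pairing a x"
  by (simp add: pairing_def sum_distrib_left mult.assoc)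

lemma pairing_sum_left: "pairing (\<lambda>t. \<Sum>i\<in>I. c i * a i t) x = (\<Sum>i\<in>I. c i * pairing (a i) x)"
  unfolding pairing_def sum_distrib_right sum_distrib_left
  by (subst sum.swap) (simp add: mult.assoc)

lemma pairing_eq_0: "(\<And>t. a t * x t = 0) \<Longrightarrow> pairing a x = 0"
  unfolding pairing_def by (rule sum.neutral) blast

text \<open>A norm bound that includes boundedness: \<open>B_norm\<close> is a bare supremum and
  says nothing about an unbounded functional. It also spares normalising the test vectors.\<close>

definition B_le :: "real \<Rightarrow> (nat \<Rightarrow> real) \<Rightarrow> bool" where
  "B_le D a \<longleftrightarrow> (\<forall>x. fin_supp x \<longrightarrow> \<bar>pairing a x\<bar> \<le> D * jt_norm x)"

lemma B_pairings_eq: "B_pairings a = {\<bar>pairing a x\<bar> | x. fin_supp x \<and> jt_norm x \<le> 1}"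
  by (simp add: B_pairings_def pairing_def)

lemma B_pairings_nonempty: "0 \<in> B_pairings a"
  unfolding B_pairings_eq by (intro CollectI exI[of _ "\<lambda>t. 0"]) simp

lemma B_le_imp_bound:
  assumes "B_le D a" "0 \<le> D"
  shows "B_bounded a" "B_norm a \<le> D"
proof -
  have *: "u \<le> D" if u: "u \<in> B_pairings a" for u
  proof -
    obtain x where x: "u = \<bar>pairing a x\<bar>" "fin_supp x" "jt_norm x \<le> 1"
      using u by (auto simp: B_pairings_eq)
    then have "u \<le> D * jt_norm x" using assms by (simp add: B_le_def)
    also have "\<dots> \<le> D * 1" using x assms by (intro mult_left_mono) auto
    finally show ?thesis by simp
  qed
  then show "B_bounded a" by (auto simp: B_bounded_def bdd_above_def)
  show "B_norm a \<le> D" unfolding B_norm_def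
    using * B_pairings_nonempty by (intro cSup_least) auto
qed

lemma B_norm_nonneg: "B_bounded a \<Longrightarrow> 0 \<le> B_norm a"
  unfolding B_norm_def B_bounded_def by (rule cSup_upper[OF B_pairings_nonempty])

lemma B_le_B_norm:
  assumes "B_bounded a"
  shows "B_le (B_norm a) a"
  unfolding B_le_def
proof (intro allI impI)
  fix x assume x: "fin_supp x"
  show "\<bar>pairing a x\<bar> \<le> B_norm a * jt_norm x"
  proof (cases "jt_norm x = 0")
    case True
    then have "x = (\<lambda>t. 0)" using jt_norm_eq_0D[OF x] by blast
    then show ?thesis by simp
  next
    case False
    then have pos: "0 < jt_norm x" using jt_norm_nonneg[OF x] by simp
    let ?y = "\<lambda>t. inverse (jt_norm x) * x t"
    have "jt_norm ?y \<le> 1" using jt_norm_mult_le[OF x, of "inverse (jt_norm x)"] pos by simp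
    then have "\<bar>pairing a ?y\<bar> \<in> B_pairings a"
      unfolding B_pairings_eq using x by blast
    then have "\<bar>pairing a ?y\<bar> \<le> B_norm a"
      unfolding B_norm_def using assms by (intro cSup_upper) (auto simp: B_bounded_def)
    then have "inverse (jt_norm x) * \<bar>pairing a x\<bar> \<le> B_norm a"
      using pos by (simp add: pairing_mult abs_mult)
    then show ?thesis using pos by (simp add: field_simps)
  qed
qed

lemma B_le_add: "B_le D a \<Longrightarrow> B_le E b \<Longrightarrow> B_le (D + E) (\<lambda>t. a t + b t)"
  unfolding B_le_def pairing_add_left distrib_right
  by (intro allI impI order_trans[OF abs_triangle_ineq] add_mono) auto

lemma B_le_mult: "B_le D a \<Longrightarrow> B_le (\<bar>c\<bar> * D) (\<lambda>t. c * a t)"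
  unfolding B_le_def pairing_mult_left by (simp add: abs_mult mult.assoc mult_left_mono)

lemma B_le_diff: "B_le D a \<Longrightarrow> B_le E b \<Longrightarrow> B_le (D + E) (\<lambda>t. a t - b t)"
  using B_le_add[of D a E "\<lambda>t. - 1 * b t"] B_le_mult[of E b "-1"] by simp

lemma B_le_fin_supp:
  assumes "fin_supp b"
  shows "B_le (\<Sum>t | b t \<noteq> 0. \<bar>b t\<bar>) b"
  unfolding B_le_def
proof (intro allI impI)
  fix x assume x: "fin_supp x"
  have "pairing b x = (\<Sum>t | b t \<noteq> 0 \<and> x t \<noteq> 0. b t * x t)"
    using x unfolding pairing_def fin_supp_def by (intro sum.mono_neutral_right) auto
  also have "\<bar>\<dots>\<bar> \<le> (\<Sum>t | b t \<noteq> 0 \<and> x t \<noteq> 0. \<bar>b t\<bar> * jt_norm x)"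
    by (intro order_trans[OF sum_abs] sum_mono) (simp add: abs_mult mult_left_mono abs_le_jt_norm x)
  also have "\<dots> \<le> (\<Sum>t | b t \<noteq> 0. \<bar>b t\<bar> * jt_norm x)"
    using assms jt_norm_nonneg[OF x] by (intro sum_mono2) (auto simp: fin_supp_def)
  finally show "\<bar>pairing b x\<bar> \<le> (\<Sum>t | b t \<noteq> 0. \<bar>b t\<bar>) * jt_norm x"
    by (simp add: sum_distrib_right)
qed

lemma Bsp_bounded:
  assumes "a \<in> Bsp"
  shows "B_bounded a"
proof -
  obtain b where b: "fin_supp b" "B_bounded (\<lambda>t. a t - b t)"
    using assms unfolding Bsp_def by (auto dest: spec[of _ 1])
  have "B_le (B_norm (\<lambda>t. a t - b t) + (\<Sum>t | b t \<noteq> 0. \<bar>b t\<bar>)) a"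
    using B_le_add[OF B_le_B_norm[OF b(2)] B_le_fin_supp[OF b(1)]] by simp
  then show ?thesis
    by (rule B_le_imp_bound(1)) (simp add: B_norm_nonneg[OF b(2)] sum_nonneg)
qed

text \<open>\<open>J\<close> is the norm of the unit vector at \<open>t\<close>. The bound turns
  norm limits into coordinatewise limits.\<close>

lemma coordinate_bound:
  obtains J where "0 \<le> J" "\<And>D a. B_le D a \<Longrightarrow> \<bar>a t\<bar> \<le> D * J"
proof
  let ?e = "\<lambda>s. if s = t then 1 else 0 :: real"
  have fin: "fin_supp ?e" by (simp add: fin_supp_def)
  show "0 \<le> jt_norm ?e" by (rule jt_norm_nonneg[OF fin])
  fix D a assume "B_le D a"
  then have "\<bar>pairing a ?e\<bar> \<le> D * jt_norm ?e" using fin by (simp add: B_le_def)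
  moreover have "pairing a ?e = (\<Sum>s\<in>{t}. a s * ?e s)"
    unfolding pairing_def by (rule sum.cong) auto
  ultimately show "\<bar>a t\<bar> \<le> D * jt_norm ?e" by simp
qed

text \<open>Here the closed span differs from the whole dual: a finitely supported approximant
  \<open>b\<close> does not see vectors beyond its support, so only the small \<open>a - b\<close>
  acts on them.\<close>

lemma Bsp_tail:
  assumes "a \<in> Bsp" "0 < d"
  shows "\<exists>q. \<forall>y. fin_supp y \<longrightarrow> (\<forall>t<q. y t = 0) \<longrightarrow> \<bar>pairing a y\<bar> \<le> d * jt_norm y"
proof -
  obtain b where b: "fin_supp b" "B_bounded (\<lambda>t. a t - b t)" "B_norm (\<lambda>t. a t - b t) < d"
    using assms unfolding Bsp_def by blast
  obtain q where q: "\<forall>t\<ge>q. b t = 0" using b(1) by (auto simp: fin_supp_iff)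
  have "\<bar>pairing a y\<bar> \<le> d * jt_norm y" if y: "fin_supp y" "\<forall>t<q. y t = 0" for y
  proof -
    have "b t * y t = 0" for t using q y by (cases "t < q") auto
    then have "pairing b y = 0" by (rule pairing_eq_0)
    then have "\<bar>pairing a y\<bar> \<le> B_norm (\<lambda>t. a t - b t) * jt_norm y"
      using B_le_B_norm[OF b(2)] y(1) by (auto simp: B_le_def pairing_diff_left dest!: spec[of _ y])
    also have "\<dots> \<le> d * jt_norm y" using b(3) jt_norm_nonneg[OF y(1)] by (intro mult_right_mono) auto
    finally show ?thesis .
  qed
  then show ?thesis by blast
qed

text \<open>\<open>g n\<close> ignores \<open>x\<close> before block n. On the block, Cauchy-Schwarz
  meets \<open>jt_norm_restr_blocks\<close>; after it the tails are summable. The constant 3 is 1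
  for the blocks plus 2 bounding the powers of 1/2.\<close>

lemma B_upper_2_estimate:
  assumes q: "mono q" and zero: "\<And>n t. t < q n \<Longrightarrow> g n t = 0" and le: "\<And>n. B_le C (g n)" and "0 \<le> C"
    and tail: "\<And>n y. fin_supp y \<Longrightarrow> (\<And>t. t < q (Suc n) \<Longrightarrow> y t = 0) \<Longrightarrow>
      \<bar>pairing (g n) y\<bar> \<le> C * (1/2) ^ n * jt_norm y"
  shows "B_le (3 * C * L2_set c {..<N}) (\<lambda>t. \<Sum>n<N. c n * g n t)"
  unfolding B_le_def
proof (intro allI impI)
  fix x assume x: "fin_supp x"
  define X where "X n = jt_norm (restr {q n..<q (Suc n)} x)" for n
  have X: "0 \<le> X n" for n unfolding X_def using x by (intro jt_norm_nonneg) auto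
  have jx: "0 \<le> jt_norm x" by (rule jt_norm_nonneg[OF x])
  have each: "\<bar>pairing (g n) x\<bar> \<le> C * (X n + (1/2) ^ n * jt_norm x)" for n
  proof -
    have "pairing (g n) x = pairing (g n) (\<lambda>t. restr {..<q n} x t + (restr {q n..<q (Suc n)} x t + restr {q (Suc n)..} x t))"
      using monoD[OF q, of n "Suc n"]
      by (intro arg_cong[of _ _ "pairing (g n)"]) (auto simp: restr_def fun_eq_iff)
    also have "\<dots> = pairing (g n) (restr {..<q n} x) + (pairing (g n) (restr {q n..<q (Suc n)} x) + pairing (g n) (restr {q (Suc n)..} x))"
      using x by (subst pairing_add, auto)+
    also have "pairing (g n) (restr {..<q n} x) = 0"
      by (rule pairing_eq_0) (simp add: restr_def zero)
    finally have eq: "pairing (g n) x = pairing (g n) (restr {q n..<q (Suc n)} x) + pairing (g n) (restr {q (Suc n)..} x)" by simp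
    have 1: "\<bar>pairing (g n) (restr {q n..<q (Suc n)} x)\<bar> \<le> C * X n"
      using le[of n] x by (auto simp: B_le_def X_def)
    have "\<bar>pairing (g n) (restr {q (Suc n)..} x)\<bar> \<le> C * (1/2) ^ n * jt_norm (restr {q (Suc n)..} x)"
      using x by (intro tail fin_supp_restr) (auto simp: restr_def)
    also have "\<dots> \<le> C * (1/2) ^ n * jt_norm x"
      using \<open>0 \<le> C\<close> x by (intro mult_left_mono jt_norm_restr_atLeast_le) auto
    finally show ?thesis using 1 unfolding eq by (simp add: algebra_simps)
  qed
  have LX: "L2_set X {..<N} \<le> jt_norm x"
    unfolding L2_set_def using jt_norm_restr_blocks[OF x q, of N] jx
    by (intro real_le_lsqrt) (auto simp: X_def sum_nonneg)
  have "(\<Sum>n<N. (1/2 :: real) ^ n) \<le> 2"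
    using sum_half_power_le[of id 0 N] by (simp add: strict_mono_def atLeast0LessThan)
  then have Lp: "L2_set (\<lambda>n. (1/2) ^ n) {..<N} \<le> 2"
    using L2_set_le_sum[of "{..<N}" "\<lambda>n. (1/2 :: real) ^ n"] by simp
  have "\<bar>pairing (\<lambda>t. \<Sum>n<N. c n * g n t) x\<bar> \<le> (\<Sum>n<N. \<bar>c n\<bar> * \<bar>pairing (g n) x\<bar>)"
    unfolding pairing_sum_left by (rule order_trans[OF sum_abs]) (simp add: abs_mult)
  also have "\<dots> \<le> (\<Sum>n<N. \<bar>c n\<bar> * (C * (X n + (1/2) ^ n * jt_norm x)))"
    by (intro sum_mono mult_left_mono each) simp
  also have "\<dots> = C * ((\<Sum>n<N. \<bar>c n\<bar> * \<bar>X n\<bar>) + (\<Sum>n<N. \<bar>c n\<bar> * \<bar>(1/2) ^ n\<bar>) * jt_norm x)"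
    using X by (simp add: sum_distrib_left sum_distrib_right sum.distrib[symmetric] algebra_simps)
  also have "\<dots> \<le> C * (L2_set c {..<N} * L2_set X {..<N} + (L2_set c {..<N} * L2_set (\<lambda>n. (1/2) ^ n) {..<N}) * jt_norm x)"
    using \<open>0 \<le> C\<close> jx by (intro mult_left_mono add_mono mult_right_mono L2_set_mult_ineq) auto
  also have "\<dots> \<le> C * (L2_set c {..<N} * jt_norm x + (L2_set c {..<N} * 2) * jt_norm x)"
    using \<open>0 \<le> C\<close> jx LX Lp by (intro mult_left_mono add_mono mult_right_mono) auto
  also have "\<dots> = 3 * C * L2_set c {..<N} * jt_norm x" by (simp add: algebra_simps)
  finally show "\<bar>pairing (\<lambda>t. \<Sum>n<N. c n * g n t) x\<bar> \<le> 3 * C * L2_set c {..<N} * jt_norm x" .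
qed

subsection \<open>Biorthogonalisation\<close>

text \<open>Forward substitution for the triangular system in which \<open>z k\<close> is the sum of
  \<open>\<theta> n k * w n\<close> over \<open>n \<le> k\<close>, solved for \<open>w\<close>
  coordinate by coordinate.\<close>

function gram :: "(nat \<Rightarrow> nat \<Rightarrow> real) \<Rightarrow> (nat \<Rightarrow> nat \<Rightarrow> real) \<Rightarrow> nat \<Rightarrow> nat \<Rightarrow> real" where
  "gram \<theta> z k t = (z k t - (\<Sum>n<k. \<theta> n k * gram \<theta> z n t)) / \<theta> k k"
  by auto
termination by (relation "Wellfounded.measure (\<lambda>(\<theta>, z, k, t). k)") auto

declare gram.simps [simp del]

text \<open>The matrix \<open>\<theta>\<close> is triangular with diagonal at least 1/2 and
  geometrically small columns off it. So \<open>w k\<close> is \<open>z k\<close> scaled by at most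
  2 plus a remainder of norm at most \<open>2 * K * (1/2) ^ k\<close>; the scaled part contributes 2
  and the remainders 4 to the constant 6.\<close>

lemma biorthogonal_perturbation:
  fixes g z :: "nat \<Rightarrow> nat \<Rightarrow> real"
  defines "\<theta> \<equiv> \<lambda>n k. pairing (g n) (z k)"
  assumes fin: "\<And>k. fin_supp (z k)" and le: "\<And>k. jt_norm (z k) \<le> K"
    and zero: "\<And>n k. k < n \<Longrightarrow> \<theta> n k = 0" and diag: "\<And>k. 1/2 \<le> \<theta> k k"
    and small: "\<And>k. (\<Sum>n<k. \<bar>\<theta> n k\<bar>) \<le> 1/4 * (1/2) ^ k"
    and upper: "\<And>N c. jt_norm (\<lambda>t. \<Sum>n<N. c n * z n t) \<le> K * L2_set c {..<N}"
  obtains w where "\<And>k. fin_supp (w k)" "\<And>n k. pairing (g n) (w k) = (if n = k then 1 else 0)"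
    "\<And>N c. jt_norm (\<lambda>t. \<Sum>n<N. c n * w n t) \<le> 6 * K * L2_set c {..<N}"
proof -
  define w where "w = gram \<theta> z"
  have K: "0 \<le> K" using le[of 0] jt_norm_nonneg[OF fin[of 0]] by linarith
  have dpos: "0 < \<theta> k k" "\<bar>1 / \<theta> k k\<bar> \<le> 2" for k using diag[of k] by (auto simp: divide_simps)
  define r where "r k t = (\<Sum>n<k. (- \<theta> n k / \<theta> k k) * w n t)" for k t
  have w_eq: "w k = (\<lambda>t. (1 / \<theta> k k) * z k t + r k t)" for k
    unfolding w_def r_def
    by (rule ext, subst gram.simps) (simp add: diff_divide_distrib sum_divide_distrib sum_negf)
  have fw: "fin_supp (w k)" for k
  proof (induction k rule: less_induct)
    case (less k)
    then have "fin_supp (r k)" unfolding r_def by (intro fin_supp_sum fin_supp_mult) auto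
    then show ?case by (subst w_eq) (intro fin_supp_add fin_supp_mult fin)
  qed
  have fr: "fin_supp (r k)" for k
    unfolding r_def by (intro fin_supp_sum fin_supp_mult fw)
  have bi: "pairing (g j) (w k) = (if j = k then 1 else 0)" for j k
  proof (induction k rule: less_induct)
    case (less k)
    have "pairing (g j) (w k) = 1 / \<theta> k k * \<theta> j k + (\<Sum>n<k. (- \<theta> n k / \<theta> k k) * pairing (g j) (w n))"
    proof -
      have "pairing (g j) (r k) = (\<Sum>n<k. (- \<theta> n k / \<theta> k k) * pairing (g j) (w n))"
        unfolding r_def by (rule pairing_sum) (rule fw)
      moreover have "pairing (g j) (w k) = pairing (g j) (\<lambda>t. (1 / \<theta> k k) * z k t) + pairing (g j) (r k)"
        by (subst w_eq) (intro pairing_add fin_supp_mult fin fr)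
      ultimately show ?thesis by (simp only: pairing_mult \<theta>_def)
    qed
    also have "(\<Sum>n<k. (- \<theta> n k / \<theta> k k) * pairing (g j) (w n)) = (\<Sum>n<k. if j = n then - \<theta> n k / \<theta> k k else 0)"
      using less by (intro sum.cong) auto
    also have "\<dots> = (if j < k then - \<theta> j k / \<theta> k k else 0)" by (simp add: sum.delta)
    finally show ?case using zero[of k j] dpos(1)[of k] by auto
  qed
  \<comment> \<open>The bound on the earlier \<open>w n\<close> is a premise, so that the induction
    proving \<open>w_le\<close> can already use this estimate.\<close>
  have r_le: "jt_norm (r k) \<le> 2 * K * (1/2) ^ k" if "\<And>n. n < k \<Longrightarrow> jt_norm (w n) \<le> 4 * K" for k
  proof -
    have "jt_norm (r k) \<le> (\<Sum>n<k. \<bar>- \<theta> n k / \<theta> k k\<bar> * jt_norm (w n))"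
      unfolding r_def by (rule jt_norm_sum_le) (rule fw)
    also have "\<dots> \<le> (\<Sum>n<k. (2 * \<bar>\<theta> n k\<bar>) * (4 * K))"
    proof (intro sum_mono mult_mono)
      fix n assume "n \<in> {..<k}"
      show "\<bar>- \<theta> n k / \<theta> k k\<bar> \<le> 2 * \<bar>\<theta> n k\<bar>"
        using mult_left_mono[OF dpos(2)[of k], of "\<bar>\<theta> n k\<bar>"] by (simp add: abs_mult)
    qed (use that in \<open>auto intro: jt_norm_nonneg fw\<close>)
    also have "\<dots> = 8 * K * (\<Sum>n<k. \<bar>\<theta> n k\<bar>)" by (simp add: sum_distrib_left algebra_simps)
    also have "\<dots> \<le> 8 * K * (1/4 * (1/2) ^ k)" using K by (intro mult_left_mono small) auto
    finally show ?thesis by simp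
  qed
  have w_le: "jt_norm (w k) \<le> 4 * K" for k
  proof (induction k rule: less_induct)
    case (less k)
    have "jt_norm (w k) \<le> jt_norm (\<lambda>t. (1 / \<theta> k k) * z k t) + jt_norm (r k)"
      unfolding w_eq by (intro jt_norm_triangle fin_supp_mult fin fr)
    also have "\<dots> \<le> \<bar>1 / \<theta> k k\<bar> * jt_norm (z k) + 2 * K * (1/2) ^ k"
      using less by (intro add_mono jt_norm_mult_le fin r_le) auto
    also have "\<dots> \<le> 2 * K + 2 * K * 1"
      using K dpos(2)[of k] le[of k] jt_norm_nonneg[OF fin[of k]]
      by (intro add_mono mult_mono mult_left_mono power_le_one) auto
    finally show ?case by simp
  qed
  have "jt_norm (\<lambda>t. \<Sum>n<N. c n * w n t) \<le> 6 * K * L2_set c {..<N}" for N c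
  proof -
    let ?L = "L2_set c {..<N}"
    have c_le: "\<bar>c n\<bar> \<le> ?L" if "n < N" for n
      using member_le_L2_set[of "{..<N}" n "\<lambda>n. \<bar>c n\<bar>"] that by (simp add: L2_set_def)
    have "L2_set (\<lambda>n. c n / \<theta> n n) {..<N} = L2_set (\<lambda>n. \<bar>c n / \<theta> n n\<bar>) {..<N}"
      unfolding L2_set_def power2_abs ..
    also have "\<dots> \<le> L2_set (\<lambda>n. 2 * \<bar>c n\<bar>) {..<N}"
    proof (rule L2_set_mono)
      show "\<bar>c n / \<theta> n n\<bar> \<le> 2 * \<bar>c n\<bar>" for n
        using mult_left_mono[OF dpos(2)[of n], of "\<bar>c n\<bar>"] by (simp add: abs_mult)
    qed simp
    also have "\<dots> = 2 * ?L"
      by (simp add: L2_set_def power_mult_distrib sum_distrib_left[symmetric] real_sqrt_mult)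
    finally have 1: "jt_norm (\<lambda>t. \<Sum>n<N. (c n / \<theta> n n) * z n t) \<le> K * (2 * ?L)"
      using upper[where N = N and c = "\<lambda>n. c n / \<theta> n n"] K by (meson mult_left_mono order_trans)
    have "jt_norm (\<lambda>t. \<Sum>n<N. c n * r n t) \<le> (\<Sum>n<N. \<bar>c n\<bar> * jt_norm (r n))"
      by (rule jt_norm_sum_le) (rule fr)
    also have "\<dots> \<le> (\<Sum>n<N. ?L * (2 * K * (1/2) ^ n))"
      using c_le by (intro sum_mono mult_mono r_le w_le jt_norm_nonneg fr) auto
    also have "\<dots> = 2 * K * ?L * (\<Sum>n<N. (1/2) ^ n)" by (simp add: sum_distrib_left algebra_simps)
    also have "\<dots> \<le> 2 * K * ?L * 2"
      using sum_half_power_le[of id 0 N] K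
      by (intro mult_left_mono) (auto simp: strict_mono_def atLeast0LessThan)
    finally have 2: "jt_norm (\<lambda>t. \<Sum>n<N. c n * r n t) \<le> 2 * K * ?L * 2" .
    have w_sum: "(\<lambda>t. \<Sum>n<N. c n * w n t) = (\<lambda>t. (\<Sum>n<N. (c n / \<theta> n n) * z n t) + (\<Sum>n<N. c n * r n t))"
      unfolding w_eq by (simp add: sum.distrib[symmetric] distrib_left)
    have "jt_norm (\<lambda>t. \<Sum>n<N. c n * w n t)
        \<le> jt_norm (\<lambda>t. \<Sum>n<N. (c n / \<theta> n n) * z n t) + jt_norm (\<lambda>t. \<Sum>n<N. c n * r n t)"
      unfolding w_sum by (intro jt_norm_triangle fin_supp_sum fin_supp_mult fin fr)
    then show ?thesis using 1 2 by simp
  qed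
  with fw bi show ?thesis using that by blast
qed

subsection \<open>A criterion for complemented copies of the sequence space\<close>

lemma L2_set_le_l2_norm: "c \<in> l2 \<Longrightarrow> L2_set c {..<N} \<le> l2_norm c"
  unfolding L2_set_def l2_norm_def l2_def
  by (intro real_sqrt_le_mono sum_le_suminf) auto

lemma l2_norm_nonneg: "c \<in> l2 \<Longrightarrow> 0 \<le> l2_norm c"
  by (simp add: l2_norm_def l2_def suminf_nonneg)

lemma l2_norm_leI:
  assumes "\<And>N. L2_set c {..<N} \<le> D"
  shows "c \<in> l2" "l2_norm c \<le> D"
proof -
  have D: "0 \<le> D" using assms[of 0] by simp
  have *: "(\<Sum>n<N. (c n)\<^sup>2) \<le> D\<^sup>2" for N
    using assms[of N] unfolding L2_set_def by (rule sqrt_le_D)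
  have sm: "summable (\<lambda>n. (c n)\<^sup>2)"
    by (rule summableI_nonneg_bounded[OF _ *]) simp
  then show "c \<in> l2" by (simp add: l2_def)
  have "(\<Sum>n. (c n)\<^sup>2) \<le> D\<^sup>2" by (rule suminf_le_const[OF sm *])
  then show "l2_norm c \<le> D" unfolding l2_norm_def using D by (intro real_le_lsqrt)
qed

lemma l2_tail:
  assumes "c \<in> l2"
  shows "(\<lambda>n. if n < N then 0 else c n) \<in> l2"
    and "(\<lambda>N. l2_norm (\<lambda>n. if n < N then 0 else c n)) \<longlonglongrightarrow> 0"
proof -
  have sm: "summable (\<lambda>n. (c n)\<^sup>2)" using assms by (simp add: l2_def)
  have "(\<lambda>n. if n \<in> {..<N} then (c n)\<^sup>2 else 0) sums (\<Sum>n<N. (c n)\<^sup>2)" for N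
    by (rule sums_If_finite_set) simp
  then have "(\<lambda>n. (c n)\<^sup>2 - (if n \<in> {..<N} then (c n)\<^sup>2 else 0)) sums ((\<Sum>n. (c n)\<^sup>2) - (\<Sum>n<N. (c n)\<^sup>2))" for N
    by (intro sums_diff summable_sums[OF sm])
  moreover have "(\<lambda>n. (c n)\<^sup>2 - (if n \<in> {..<N} then (c n)\<^sup>2 else 0)) = (\<lambda>n. (if n < N then 0 else c n)\<^sup>2)" for N
    by (auto simp: fun_eq_iff)
  ultimately have *: "(\<lambda>n. (if n < N then 0 else c n)\<^sup>2) sums ((\<Sum>n. (c n)\<^sup>2) - (\<Sum>n<N. (c n)\<^sup>2))" for N
    by simp
  then show "(\<lambda>n. if n < N then 0 else c n) \<in> l2" by (auto simp: l2_def sums_iff)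
  have "l2_norm (\<lambda>n. if n < N then 0 else c n) = sqrt ((\<Sum>n. (c n)\<^sup>2) - (\<Sum>n<N. (c n)\<^sup>2))" for N
    unfolding l2_norm_def using sums_unique[OF *[of N]] by simp
  moreover have "(\<lambda>N. sqrt ((\<Sum>n. (c n)\<^sup>2) - (\<Sum>n<N. (c n)\<^sup>2))) \<longlonglongrightarrow> sqrt ((\<Sum>n. (c n)\<^sup>2) - (\<Sum>n. (c n)\<^sup>2))"
    by (intro tendsto_intros summable_LIMSEQ sm)
  ultimately show "(\<lambda>N. l2_norm (\<lambda>n. if n < N then 0 else c n)) \<longlonglongrightarrow> 0" by simp
qed

lemma lin_subspace_add:
  assumes "lin_subspace M" "a \<in> M" "b \<in> M"
  shows "(\<lambda>t. a t + b t) \<in> M"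
  using assms by (simp add: lin_subspace_def)

lemma lin_subspace_mult:
  assumes "lin_subspace M" "a \<in> M"
  shows "(\<lambda>t. c * a t) \<in> M"
  using assms by (simp add: lin_subspace_def)

text \<open>\<open>S\<close> reads off coefficients against \<open>w\<close> and \<open>T\<close>
  sums them against \<open>g\<close>. Biorthogonality makes \<open>S\<close> a left inverse of
  \<open>T\<close>, so \<open>T\<close> after \<open>S\<close> is a projection; the estimate for
  \<open>w\<close> bounds \<open>S\<close>, and thereby \<open>T\<close> from below.\<close>

lemma complemented_l2_criterion:
  fixes g w :: "nat \<Rightarrow> nat \<Rightarrow> real"
  assumes M: "M \<subseteq> Bsp" "lin_subspace M" "B_closed M"
    and g: "\<And>n. g n \<in> M" "\<And>n t. t < n \<Longrightarrow> g n t = 0" and w: "\<And>n. fin_supp (w n)"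
    and biorth: "\<And>n k. pairing (g n) (w k) = (if n = k then 1 else 0)"
    and g_upper: "\<And>N c. B_le (C * L2_set c {..<N}) (\<lambda>t. \<Sum>n<N. c n * g n t)" and C: "0 < C"
    and w_upper: "\<And>N c. jt_norm (\<lambda>t. \<Sum>n<N. c n * w n t) \<le> K * L2_set c {..<N}" and K: "0 < K"
  shows "\<exists>Y. Y \<subseteq> M \<and> lin_subspace Y \<and> B_closed Y \<and> iso_to_l2 Y \<and> complemented_in_B Y"
proof -
  \<comment> \<open>\<open>g n\<close> vanishes below \<open>n\<close>, so each coordinate meets
    finitely many terms and \<open>T c\<close> makes sense for every sequence
    \<open>c\<close>.\<close>
  define T where "T c = (\<lambda>t. \<Sum>n\<le>t. c n * g n t)" for c :: "nat \<Rightarrow> real"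
  define S where "S a = (\<lambda>k. pairing a (w k))" for a
  have T_eq: "T c t = (\<Sum>n<N. c n * g n t)" if "t < N" for c t N
    unfolding T_def using that g(2) by (intro sum.mono_neutral_left) auto
  have T_pairing: "pairing (T c) x = (\<Sum>n<N. c n * pairing (g n) x)" if "\<And>t. N \<le> t \<Longrightarrow> x t = 0" for c x N
  proof -
    have "pairing a x = (\<Sum>t<N. a t * x t)" for a
      by (rule pairing_eq_sum_lessThan) (rule that)
    then have "pairing (T c) x = pairing (\<lambda>t. \<Sum>n<N. c n * g n t) x"
      by (auto simp: T_eq[of _ N] intro!: sum.cong)
    then show ?thesis by (simp add: pairing_sum_left)
  qed
  have T_add: "T (\<lambda>n. c n + d n) = (\<lambda>t. T c t + T d t)" for c d
    by (simp add: T_def fun_eq_iff sum.distrib distrib_right)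
  have T_mult: "T (\<lambda>n. r * c n) = (\<lambda>t. r * T c t)" for r c
    by (simp add: T_def fun_eq_iff sum_distrib_left mult.assoc)
  have T_le: "B_le (C * l2_norm c) (T c)" if c: "c \<in> l2" for c
    unfolding B_le_def
  proof (intro allI impI)
    fix x assume x: "fin_supp x"
    then obtain N where N: "\<And>t. N \<le> t \<Longrightarrow> x t = 0" by (auto simp: fin_supp_iff)
    have "\<bar>pairing (T c) x\<bar> \<le> C * L2_set c {..<N} * jt_norm x"
      using g_upper[of c N] x T_pairing[OF N] by (simp add: B_le_def pairing_sum_left)
    also have "\<dots> \<le> C * l2_norm c * jt_norm x"
      using C L2_set_le_l2_norm[OF c] jt_norm_nonneg[OF x] by (intro mult_right_mono mult_left_mono) auto
    finally show "\<bar>pairing (T c) x\<bar> \<le> C * l2_norm c * jt_norm x" .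
  qed
  have T_norm: "B_bounded (T c)" "B_norm (T c) \<le> C * l2_norm c" if c: "c \<in> l2" for c
    using B_le_imp_bound[OF T_le[OF c]] C l2_norm_nonneg[OF c] by auto
  have ST: "S (T c) = c" for c
  proof
    fix k
    obtain L where L: "\<And>t. L \<le> t \<Longrightarrow> w k t = 0" using w[of k] by (auto simp: fin_supp_iff)
    have "S (T c) k = (\<Sum>n<max L (Suc k). c n * (if n = k then 1 else 0))"
      unfolding S_def using L by (subst T_pairing[where N = "max L (Suc k)"]) (auto simp: biorth)
    also have "\<dots> = c k" by (simp add: if_distrib[of "(*) _"] sum.delta cong: if_cong)
    finally show "S (T c) k = c k" .
  qed
  have S_add: "S (\<lambda>t. a t + b t) = (\<lambda>k. S a k + S b k)" for a b
    by (simp add: S_def pairing_add_left)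
  have S_diff: "S (\<lambda>t. a t - b t) = (\<lambda>k. S a k - S b k)" for a b
    by (simp add: S_def pairing_diff_left)
  have S_mult: "S (\<lambda>t. r * a t) = (\<lambda>k. r * S a k)" for r a
    by (simp add: S_def pairing_mult_left)
  \<comment> \<open>Duality: \<open>a\<close> is tested on the combination of the \<open>w k\<close>
    whose coefficients are the \<open>S a k\<close> themselves, which gives
    \<open>q * q \<le> D * K * q\<close>.\<close>
  have S_le: "L2_set (S a) {..<N} \<le> D * K" if a: "B_le D a" "0 \<le> D" for a D N
  proof -
    define q where "q = L2_set (S a) {..<N}"
    have q: "0 \<le> q" by (simp add: q_def)
    have "q * q = (\<Sum>k<N. S a k * pairing a (w k))"
      by (simp add: q_def L2_set_def S_def power2_eq_square sum_nonneg)
    also have "\<dots> = pairing a (\<lambda>t. \<Sum>k<N. S a k * w k t)" by (simp add: pairing_sum w)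
    also have "\<dots> \<le> D * jt_norm (\<lambda>t. \<Sum>k<N. S a k * w k t)"
    proof -
      have "fin_supp (\<lambda>t. \<Sum>k<N. S a k * w k t)" by (intro fin_supp_sum fin_supp_mult w)
      then show ?thesis using a(1) by (auto simp: B_le_def intro: order_trans[OF abs_ge_self])
    qed
    also have "\<dots> \<le> D * (K * q)" unfolding q_def by (intro mult_left_mono w_upper a)
    finally have "q * q \<le> (D * K) * q" by simp
    then show ?thesis using q a K unfolding q_def[symmetric] by (cases "q = 0") auto
  qed
  have S_l2: "S a \<in> l2" "l2_norm (S a) \<le> B_norm a * K" if a: "B_bounded a" for a
    using l2_norm_leI[OF S_le[OF B_le_B_norm[OF a] B_norm_nonneg[OF a]]] by auto
  define u where "u c N = (\<lambda>t. \<Sum>n<N. c n * g n t)" for c :: "nat \<Rightarrow> real" and N :: nat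
  have uM: "u c N \<in> M" for c N
  proof (induction N)
    case 0
    then show ?case using M(2) by (simp add: u_def lin_subspace_def)
  next
    case (Suc N)
    have "(\<lambda>t. u c N t + c N * g N t) \<in> M"
      by (intro lin_subspace_add[OF M(2)] lin_subspace_mult[OF M(2)] Suc g(1))
    then show ?case by (simp add: u_def)
  qed
  have u_eq: "(\<lambda>t. T c t - u c N t) = T (\<lambda>n. if n < N then 0 else c n)" for c N
  proof
    fix t
    have "T c t - u c N t = (\<Sum>n<max N (Suc t). c n * g n t) - (\<Sum>n<max N (Suc t). if n < N then c n * g n t else 0)"
      unfolding u_def by (subst T_eq[of t "max N (Suc t)"])
        (auto intro!: sum.mono_neutral_cong_left split: if_splits)
    also have "\<dots> = (\<Sum>n<max N (Suc t). (if n < N then 0 else c n) * g n t)"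
      by (auto simp: sum_subtractf[symmetric] intro!: sum.cong)
    also have "\<dots> = T (\<lambda>n. if n < N then 0 else c n) t" by (rule T_eq[symmetric]) simp
    finally show "T c t - u c N t = T (\<lambda>n. if n < N then 0 else c n) t" .
  qed
  have T_lim: "(\<lambda>N. B_norm (\<lambda>t. T c t - u c N t)) \<longlonglongrightarrow> 0" if c: "c \<in> l2" for c
  proof (rule tendsto_sandwich)
    show "\<forall>\<^sub>F N in sequentially. 0 \<le> B_norm (\<lambda>t. T c t - u c N t)"
      unfolding u_eq by (intro always_eventually allI B_norm_nonneg T_norm(1) l2_tail c)
    show "\<forall>\<^sub>F N in sequentially. B_norm (\<lambda>t. T c t - u c N t) \<le> C * l2_norm (\<lambda>n. if n < N then 0 else c n)"
      unfolding u_eq by (intro always_eventually allI T_norm(2) l2_tail c)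
    show "(\<lambda>N. C * l2_norm (\<lambda>n. if n < N then 0 else c n)) \<longlonglongrightarrow> 0"
      using tendsto_mult_right_zero[OF l2_tail(2)[OF c]] by simp
  qed simp
  have T_Bsp: "T c \<in> Bsp" if c: "c \<in> l2" for c
    unfolding Bsp_def
  proof (intro CollectI allI impI)
    fix e :: real assume "0 < e"
    then have "\<forall>\<^sub>F N in sequentially. B_norm (\<lambda>t. T c t - u c N t) < e / 2"
      by (intro order_tendstoD(2)[OF T_lim[OF c]]) simp
    then obtain N where N: "B_norm (\<lambda>t. T c t - u c N t) < e / 2"
      by (auto simp: eventually_sequentially)
    have "u c N \<in> Bsp" using uM M(1) by blast
    then obtain b where b: "fin_supp b" "B_bounded (\<lambda>t. u c N t - b t)" "B_norm (\<lambda>t. u c N t - b t) < e / 2"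
      using \<open>0 < e\<close> unfolding Bsp_def by (auto dest!: spec[of _ "e / 2"])
    have bd: "B_bounded (\<lambda>t. T c t - u c N t)"
      unfolding u_eq by (intro T_norm(1) l2_tail c)
    have "B_le (B_norm (\<lambda>t. T c t - u c N t) + B_norm (\<lambda>t. u c N t - b t)) (\<lambda>t. T c t - b t)"
      using B_le_add[OF B_le_B_norm[OF bd] B_le_B_norm[OF b(2)]] by simp
    note * = B_le_imp_bound[OF this add_nonneg_nonneg[OF B_norm_nonneg[OF bd] B_norm_nonneg[OF b(2)]]]
    show "\<exists>b. fin_supp b \<and> B_bounded (\<lambda>t. T c t - b t) \<and> B_norm (\<lambda>t. T c t - b t) < e"
      using * b(1,3) N by (intro exI[of _ b]) auto
  qed
  have B_norm_swap: "B_norm (\<lambda>t. a t - b t) = B_norm (\<lambda>t. b t - a t)" for a b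
    unfolding B_norm_def B_pairings_eq pairing_diff_left by (simp add: abs_minus_commute)
  have T_M: "T c \<in> M" if c: "c \<in> l2" for c
    using M(3) uM T_Bsp[OF c] T_lim[OF c] unfolding B_closed_def
    by (subst (asm) B_norm_swap) blast
  define Y where "Y = T ` l2"
  define P where "P a = T (S a)" for a
  \<comment> \<open>Closure of \<open>l2\<close> under sums is read off from the operators:
    \<open>c + d\<close> is the image under \<open>S\<close> of the bounded functional
    \<open>T c + T d\<close>.\<close>
  have l2_add: "(\<lambda>n. c n + d n) \<in> l2" if "c \<in> l2" "d \<in> l2" for c d
  proof -
    have "S (\<lambda>t. T c t + T d t) \<in> l2"
      by (rule S_l2(1), rule B_le_imp_bound(1)[OF B_le_add[OF T_le[OF that(1)] T_le[OF that(2)]]])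
        (use C l2_norm_nonneg that in auto)
    then show ?thesis by (simp add: S_add ST)
  qed
  have l2_mult: "(\<lambda>n. r * c n) \<in> l2" if "c \<in> l2" for r c
    using that by (simp add: l2_def power_mult_distrib summable_mult)
  have l2_zero: "(\<lambda>n. 0) \<in> l2" by (simp add: l2_def)
  have P_norm: "B_norm (P a) \<le> C * K * B_norm a" if a: "B_bounded a" for a
  proof -
    have "B_norm (P a) \<le> C * l2_norm (S a)" unfolding P_def by (rule T_norm(2)[OF S_l2(1)[OF a]])
    also have "\<dots> \<le> C * (B_norm a * K)" using C S_l2(2)[OF a] by (intro mult_left_mono) auto
    finally show ?thesis by (simp add: mult_ac)
  qed
  have P_T: "P (T c) = T c" for c by (simp add: P_def ST)
  have "Y \<subseteq> M" using T_M by (auto simp: Y_def)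
  moreover have "lin_subspace Y"
    unfolding lin_subspace_def
  proof (intro conjI ballI allI)
    have "T (\<lambda>n. 0) = (\<lambda>t. 0)" by (simp add: T_def)
    then show "(\<lambda>t. 0) \<in> Y" unfolding Y_def using l2_zero by (metis image_eqI)
  next
    fix a b assume "a \<in> Y" "b \<in> Y"
    then obtain c d where "a = T c" "b = T d" "c \<in> l2" "d \<in> l2" by (auto simp: Y_def)
    then show "(\<lambda>t. a t + b t) \<in> Y" unfolding Y_def using l2_add[of c d] T_add[of c d] by (metis image_eqI)
  next
    fix r a assume "a \<in> Y"
    then obtain c where "a = T c" "c \<in> l2" by (auto simp: Y_def)
    then show "(\<lambda>t. r * a t) \<in> Y" unfolding Y_def using l2_mult[of c r] T_mult[of r c] by (metis image_eqI)
  qed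
  moreover have "B_closed Y"
    unfolding B_closed_def
  proof (intro allI impI, elim conjE)
    fix f a assume f: "\<forall>n. f n \<in> Y" and a: "a \<in> Bsp" and lim: "(\<lambda>n. B_norm (\<lambda>t. f n t - a t)) \<longlonglongrightarrow> 0"
    have abd: "B_bounded a" by (rule Bsp_bounded[OF a])
    define d where "d n = (\<lambda>t. f n t - a t)" for n
    have dbd: "B_bounded (d n)" for n
    proof -
      have "f n \<in> Y" using f by blast
      then have "B_bounded (f n)" using T_norm(1) by (auto simp: Y_def)
      then show ?thesis unfolding d_def
        by (intro B_le_imp_bound(1)[OF B_le_diff[OF B_le_B_norm B_le_B_norm]] add_nonneg_nonneg B_norm_nonneg abd)
    qed
    have Pd: "P (d n) = (\<lambda>t. f n t - P a t)" for n
    proof -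
      have "f n \<in> Y" using f by blast
      then obtain c where c: "f n = T c" by (auto simp: Y_def)
      have "P (d n) = T (\<lambda>k. S (f n) k + (- 1) * S a k)" by (simp add: P_def d_def S_diff)
      also have "\<dots> = (\<lambda>t. T (S (f n)) t + (- 1) * T (S a) t)" unfolding T_add T_mult ..
      finally show ?thesis by (simp add: P_def c ST)
    qed
    \<comment> \<open>For every \<open>n\<close>, \<open>a - P a\<close> equals
      \<open>P (d n) - d n\<close>, and both terms tend to 0 in each coordinate. So \<open>a\<close>
      is fixed by \<open>P\<close> and lies in its range.\<close>
    have "a t = P a t" for t
    proof -
      obtain J where J: "0 \<le> J" "\<And>D a. B_le D a \<Longrightarrow> \<bar>a t\<bar> \<le> D * J" by (rule coordinate_bound[where t = t]) blast
      have "\<bar>a t - P a t\<bar> \<le> B_norm (d n) * J + C * K * B_norm (d n) * J" for n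
      proof -
        have "\<bar>d n t\<bar> \<le> B_norm (d n) * J" by (rule J(2)[OF B_le_B_norm[OF dbd]])
        moreover have "\<bar>P (d n) t\<bar> \<le> B_norm (P (d n)) * J"
          using T_norm(1)[OF S_l2(1)[OF dbd]] by (intro J(2) B_le_B_norm) (simp add: P_def)
        moreover have "B_norm (P (d n)) * J \<le> C * K * B_norm (d n) * J"
          by (intro mult_right_mono P_norm dbd J(1))
        moreover have "\<bar>a t - P a t\<bar> \<le> \<bar>d n t\<bar> + \<bar>P (d n) t\<bar>" 
          using fun_cong[OF Pd[of n], of t] fun_cong[OF d_def[of n], of t] by linarith
        ultimately show ?thesis by linarith
      qed
      moreover have "(\<lambda>n. B_norm (d n) * J + C * K * B_norm (d n) * J) \<longlonglongrightarrow> 0 * J + C * K * 0 * J"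
        using lim unfolding d_def by (intro tendsto_intros)
      ultimately have "\<bar>a t - P a t\<bar> \<le> 0"
        by (intro LIMSEQ_le_const) auto
      then show ?thesis by simp
    qed
    then have "a = T (S a)" by (auto simp: P_def)
    then show "a \<in> Y" unfolding Y_def using S_l2(1)[OF abd] by blast
  qed
  moreover have "iso_to_l2 Y"
    unfolding iso_to_l2_def
  proof (intro exI[of _ T] conjI ballI allI)
    show "T ` l2 = Y" by (simp add: Y_def)
    show "\<exists>c C. 0 < c \<and> 0 < C \<and> (\<forall>x\<in>l2. c * l2_norm x \<le> B_norm (T x) \<and> B_norm (T x) \<le> C * l2_norm x)"
    proof (rule exI[of _ "1 / K"], rule exI[of _ C], intro conjI ballI)
      fix c assume c: "c \<in> l2"
      show "B_norm (T c) \<le> C * l2_norm c" by (rule T_norm(2)[OF c])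
      have "l2_norm c \<le> B_norm (T c) * K" using S_l2(2)[OF T_norm(1)[OF c]] by (simp add: ST)
      then show "1 / K * l2_norm c \<le> B_norm (T c)" using K by (simp add: field_simps)
    qed (use C K in auto)
  qed (simp_all add: T_add T_mult)
  moreover have "complemented_in_B Y"
    unfolding complemented_in_B_def
  proof (intro exI[of _ P] conjI ballI allI)
    show "P ` Bsp = Y"
    proof
      show "P ` Bsp \<subseteq> Y" using S_l2(1)[OF Bsp_bounded] by (auto simp: Y_def P_def)
      show "Y \<subseteq> P ` Bsp"
      proof
        fix y assume "y \<in> Y"
        then have "y \<in> Bsp" "y = P y" using T_Bsp P_T by (auto simp: Y_def)
        then show "y \<in> P ` Bsp" by blast
      qed
    qed
    show "\<exists>C. \<forall>a\<in>Bsp. B_norm (P a) \<le> C * B_norm a"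
      using P_norm[OF Bsp_bounded] by blast
    show "P (P a) = P a" for a unfolding P_def[of a] by (rule P_T)
    show "P (\<lambda>t. a t + b t) = (\<lambda>t. P a t + P b t)" for a b by (simp add: P_def S_add T_add)
    show "P (\<lambda>t. c * a t) = (\<lambda>t. c * P a t)" for c a by (simp add: P_def S_mult T_mult)
  qed
  ultimately show ?thesis by blast
qed

subsection \<open>Almost disjointly supported sequences in subspaces\<close>

text \<open>Gaussian elimination: a pivot \<open>v j\<close> clears coordinate \<open>m\<close> from
  the other vectors at the cost of one vector, and its own coefficient is restored at the
  end.\<close>

lemma nontrivial_dependency:
  fixes v :: "'i \<Rightarrow> nat \<Rightarrow> real"
  assumes "finite I" "m < card I"
  shows "\<exists>c. (\<exists>i\<in>I. c i \<noteq> 0) \<and> (\<forall>t<m. (\<Sum>i\<in>I. c i * v i t) = 0)"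
  using assms
proof (induction m arbitrary: I v)
  case 0
  then show ?case by (intro exI[of _ "\<lambda>_. 1"]) (auto simp: card_gt_0_iff)
next
  case (Suc m)
  show ?case
  proof (cases "\<forall>i\<in>I. v i m = 0")
    case True
    obtain c where "\<exists>i\<in>I. c i \<noteq> 0" "\<forall>t<m. (\<Sum>i\<in>I. c i * v i t) = 0"
      using Suc.IH[of I v] Suc.prems by auto
    then show ?thesis using True by (intro exI[of _ c]) (auto simp: less_Suc_eq)
  next
    case False
    then obtain j where j: "j \<in> I" "v j m \<noteq> 0" by blast
    let ?I = "I - {j}"
    define v' where "v' i t = v i t - v i m / v j m * v j t" for i t
    have "m < card ?I" using Suc.prems j by (simp add: card_Diff_singleton)
    then obtain c where c: "\<exists>i\<in>?I. c i \<noteq> 0" "\<forall>t<m. (\<Sum>i\<in>?I. c i * v' i t) = 0"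
      using Suc.IH[of ?I v'] Suc.prems(1) by blast
    have all: "(\<Sum>i\<in>?I. c i * v' i t) = 0" if "t < Suc m" for t
      using c(2) that j by (auto simp: less_Suc_eq v'_def)
    define d where "d = c(j := - (\<Sum>i\<in>?I. c i * (v i m / v j m)))"
    have "(\<Sum>i\<in>I. d i * v i t) = (\<Sum>i\<in>?I. c i * v' i t)" for t
    proof -
      have "(\<Sum>i\<in>I. d i * v i t) = d j * v j t + (\<Sum>i\<in>?I. d i * v i t)"
        using Suc.prems(1) j(1) by (rule sum.remove)
      also have "(\<Sum>i\<in>?I. d i * v i t) = (\<Sum>i\<in>?I. c i * v i t)"
        by (intro sum.cong) (auto simp: d_def)
      also have "d j * v j t = - (\<Sum>i\<in>?I. c i * (v i m / v j m * v j t))"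
        by (simp add: d_def sum_distrib_right mult.assoc)
      finally show ?thesis by (simp add: v'_def right_diff_distrib sum_subtractf)
    qed
    moreover have "\<exists>i\<in>I. d i \<noteq> 0" using c(1) by (auto simp: d_def)
    ultimately show ?thesis using all by auto
  qed
qed

lemma lin_subspace_sum:
  assumes "lin_subspace M" "finite I" "\<And>i. i \<in> I \<Longrightarrow> v i \<in> M"
  shows "(\<lambda>t. \<Sum>i\<in>I. c i * v i t) \<in> M"
  using assms(2,3)
proof (induction I)
  case empty
  then show ?case using assms(1) by (simp add: lin_subspace_def)
next
  case (insert i I)
  then have "(\<lambda>t. c i * v i t + (\<Sum>i\<in>I. c i * v i t)) \<in> M"
    by (intro lin_subspace_add[OF assms(1)] lin_subspace_mult[OF assms(1)]) auto
  then show ?case using insert.hyps by simp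
qed

lemma infinite_dim_vanishing_vector:
  assumes "lin_subspace M" "infinite_dim M"
  obtains a t where "a \<in> M" "\<And>t. t < p \<Longrightarrow> a t = 0" "a t \<noteq> 0"
proof -
  obtain v where v: "\<forall>i<Suc p. v i \<in> M"
    "\<forall>c::nat \<Rightarrow> real. (\<forall>t. (\<Sum>i<Suc p. c i * v i t) = 0) \<longrightarrow> (\<forall>i<Suc p. c i = 0)"
    using assms(2) unfolding infinite_dim_def by blast
  obtain c where c: "\<exists>i\<in>{..<Suc p}. c i \<noteq> 0" "\<forall>t<p. (\<Sum>i\<in>{..<Suc p}. c i * v i t) = 0"
    using nontrivial_dependency[of "{..<Suc p}" p v] by auto
  then obtain t where "(\<Sum>i<Suc p. c i * v i t) \<noteq> 0" using v(2) by blast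
  moreover have "(\<lambda>t. \<Sum>i<Suc p. c i * v i t) \<in> M"
    using v(1) by (intro lin_subspace_sum assms(1)) auto
  ultimately show ?thesis using that c(2) by blast
qed

text \<open>As \<open>a\<close> vanishes below \<open>p\<close>, cutting a nearly norming vector off
  below \<open>p\<close> keeps its pairing with \<open>a\<close> and does not raise its
  norm.\<close>

lemma norming_pair_beyond:
  assumes "M \<subseteq> Bsp" "lin_subspace M" "infinite_dim M"
  shows "\<exists>a x. a \<in> M \<and> B_le 1 a \<and> (\<forall>t<p. a t = 0) \<and> fin_supp x \<and> (\<forall>t<p. x t = 0) \<and>
    jt_norm x \<le> 1 \<and> 1/2 \<le> pairing a x"
proof -
  obtain a t where a: "a \<in> M" "\<And>t. t < p \<Longrightarrow> a t = 0" "a t \<noteq> 0"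
    using infinite_dim_vanishing_vector[OF assms(2,3), of p] by metis
  have bd: "B_bounded a" using a(1) assms(1) by (intro Bsp_bounded) auto
  obtain J where "\<And>D a. B_le D a \<Longrightarrow> \<bar>a t\<bar> \<le> D * J" using coordinate_bound[of t] by blast
  then have "\<bar>a t\<bar> \<le> B_norm a * J" using B_le_B_norm[OF bd] by blast
  then have pos: "0 < B_norm a" using a(3) B_norm_nonneg[OF bd] by (cases "B_norm a = 0") auto
  obtain y where y: "fin_supp y" "jt_norm y \<le> 1" "B_norm a / 2 < \<bar>pairing a y\<bar>"
  proof -
    have "B_norm a / 2 < Sup (B_pairings a)" using pos by (simp add: B_norm_def[symmetric])
    then obtain u where "u \<in> B_pairings a" "B_norm a / 2 < u"
      using B_pairings_nonempty by (metis empty_iff less_cSupE)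
    then show ?thesis using that by (auto simp: B_pairings_eq)
  qed
  define \<sigma> where "\<sigma> = sgn (pairing a y)"
  define x where "x = (\<lambda>t. \<sigma> * restr {p..} y t)"
  have "pairing a (restr {p..} y) = pairing a y"
  proof -
    obtain L where L: "\<And>t. L \<le> t \<Longrightarrow> y t = 0" using y(1) by (auto simp: fin_supp_iff)
    have "pairing a z = (\<Sum>t<L. a t * z t)" if "z \<in> {y, restr {p..} y}" for z
      using that L by (intro pairing_eq_sum_lessThan) (auto simp: restr_def)
    then show ?thesis using a(2) by (auto simp: restr_def intro!: sum.cong)
  qed
  then have px: "pairing a x = \<bar>pairing a y\<bar>"
    by (simp add: x_def pairing_mult \<sigma>_def abs_sgn mult.commute)
  have jx: "jt_norm x \<le> 1"
  proof -
    have "jt_norm x \<le> \<bar>\<sigma>\<bar> * jt_norm (restr {p..} y)" unfolding x_def by (intro jt_norm_mult_le fin_supp_restr y)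
    also have "\<dots> \<le> 1 * jt_norm y"
      using y(1) by (intro mult_mono jt_norm_restr_atLeast_le jt_norm_nonneg) (auto simp: \<sigma>_def abs_sgn_eq)
    finally show ?thesis using y(2) by simp
  qed
  let ?b = "\<lambda>t. inverse (B_norm a) * a t"
  show ?thesis
  proof (intro exI conjI)
    show "?b \<in> M" by (rule lin_subspace_mult[OF assms(2) a(1)])
    show "B_le 1 ?b" using B_le_mult[OF B_le_B_norm[OF bd], of "inverse (B_norm a)"] pos by simp
    show "\<forall>t<p. ?b t = 0" using a(2) by simp
    show "fin_supp x" unfolding x_def by (intro fin_supp_mult fin_supp_restr y)
    show "\<forall>t<p. x t = 0" by (simp add: x_def restr_def)
    show "jt_norm x \<le> 1" by (rule jx)
    show "1/2 \<le> pairing ?b x"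
      unfolding pairing_mult_left px using y(3) pos by (simp add: field_simps)
  qed
qed

lemma norming_block_sequence:
  fixes \<delta> :: "nat \<Rightarrow> real"
  assumes M: "M \<subseteq> Bsp" "lin_subspace M" "infinite_dim M" and \<delta>: "\<And>n. 0 < \<delta> n"
  obtains p :: "nat \<Rightarrow> nat" and m x where "strict_mono p"
    "\<And>n. m n \<in> M" "\<And>n. B_le 1 (m n)" "\<And>n t. t < p n \<Longrightarrow> m n t = 0"
    "\<And>n. fin_supp (x n)" "\<And>n t. x n t \<noteq> 0 \<Longrightarrow> p n \<le> t \<and> t < p (Suc n)"
    "\<And>n. jt_norm (x n) \<le> 1" "\<And>n. 1/2 \<le> pairing (m n) (x n)"
    "\<And>j n y. j < n \<Longrightarrow> fin_supp y \<Longrightarrow> (\<And>t. t < p n \<Longrightarrow> y t = 0) \<Longrightarrow> \<bar>pairing (m j) y\<bar> \<le> \<delta> n * jt_norm y"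
proof -
  \<comment> \<open>A pair is fixed for every conceivable starting point \<open>q\<close> in
    advance; the recursion below only selects starting points.\<close>
  obtain a x where a: "\<And>q. a q \<in> M" "\<And>q. B_le 1 (a q)" "\<And>q t. t < q \<Longrightarrow> a q t = 0"
    and x: "\<And>q. fin_supp (x q)" "\<And>q t. t < q \<Longrightarrow> x q t = 0" "\<And>q. jt_norm (x q) \<le> 1"
    and ax: "\<And>q. 1/2 \<le> pairing (a q) (x q)"
    using norming_pair_beyond[OF M] by metis
  have "\<forall>q. \<exists>L. \<forall>t\<ge>L. x q t = 0" using x(1) by (simp add: fin_supp_iff)
  then obtain l where l: "\<And>q t. l q \<le> t \<Longrightarrow> x q t = 0" by metis
  have "\<forall>q n. \<exists>L. \<forall>y. fin_supp y \<longrightarrow> (\<forall>t<L. y t = 0) \<longrightarrow> \<bar>pairing (a q) y\<bar> \<le> \<delta> n * jt_norm y"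
    using a(1) M(1) by (intro allI Bsp_tail \<delta>) auto
  then obtain \<tau> where \<tau>: "\<And>q n y. fin_supp y \<Longrightarrow> (\<forall>t<\<tau> q n. y t = 0) \<Longrightarrow> \<bar>pairing (a q) y\<bar> \<le> \<delta> n * jt_norm y"
    by metis
  \<comment> \<open>\<open>l q\<close> clears the support of \<open>x q\<close>. The sum dominates
    each \<open>\<tau> i (Suc n)\<close> with \<open>i \<le> q\<close>, hence those of all earlier
    starting points, so the recursion needs no record of them.\<close>
  define p where "p = rec_nat 0 (\<lambda>n q. Suc q + l q + (\<Sum>i\<le>q. \<tau> i (Suc n)))"
  have p_Suc: "p (Suc n) = Suc (p n) + l (p n) + (\<Sum>i\<le>p n. \<tau> i (Suc n))" for n
    by (simp add: p_def)
  have p: "strict_mono p" by (simp add: strict_mono_Suc_iff p_Suc)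
  show ?thesis
  proof (rule that[of p "\<lambda>n. a (p n)" "\<lambda>n. x (p n)"])
    fix n t assume t: "x (p n) t \<noteq> 0"
    have "p n \<le> t" using t x(2)[of t "p n"] by (cases "t < p n") auto
    moreover have "t < l (p n)" using t l[of "p n" t] by (cases "t < l (p n)") auto
    ultimately show "p n \<le> t \<and> t < p (Suc n)" by (simp add: p_Suc)
  next
    fix j n y assume jn: "j < n" and y: "fin_supp y" "\<And>t. t < p n \<Longrightarrow> y t = 0"
    then obtain k where k: "n = Suc k" "j \<le> k" by (cases n) auto
    have "p j \<le> p k" using k p by (simp add: strict_mono_less_eq)
    then have "\<tau> (p j) (Suc k) \<le> (\<Sum>i\<le>p k. \<tau> i (Suc k))" by (intro member_le_sum) auto
    also have "\<dots> \<le> p n" by (simp add: k p_Suc)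
    finally show "\<bar>pairing (a (p j)) y\<bar> \<le> \<delta> n * jt_norm y"
      using y by (intro \<tau>) (auto simp: k)
  qed (use a x ax p in auto)
qed

theorem mainTheorem2:
  assumes "M \<subseteq> Bsp" and "lin_subspace M" and "B_closed M" and "infinite_dim M"
  shows "\<exists>Y. Y \<subseteq> M \<and> lin_subspace Y \<and> B_closed Y \<and> iso_to_l2 Y \<and> complemented_in_B Y"
proof -
  \<comment> \<open>The factor \<open>real n + 1\<close> pays for the \<open>k\<close> off-diagonal
    entries in column \<open>k\<close> of the pairing matrix; each is at most
    \<open>4 * \<delta> k\<close>, and 16 brings their sum down to the 1/4 required for
    biorthogonalisation.\<close>
  define \<delta> where "\<delta> n = (1/2) ^ n / (16 * (real n + 1))" for n
  have \<delta>_pos: "0 < \<delta> n" for n by (simp add: \<delta>_def)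
  have \<delta>_mono: "\<delta> k \<le> \<delta> n" if "n \<le> k" for n k
    unfolding \<delta>_def using that by (intro frac_le power_decreasing) auto
  have \<delta>_le: "\<delta> n \<le> (1/2) ^ n / 16" for n
    unfolding \<delta>_def by (intro divide_left_mono) auto
  obtain p m x where p: "strict_mono p"
    and m: "\<And>n. m n \<in> M" "\<And>n. B_le 1 (m n)" "\<And>n t. t < p n \<Longrightarrow> m n t = 0"
    and x: "\<And>n. fin_supp (x n)" "\<And>n t. x n t \<noteq> 0 \<Longrightarrow> p n \<le> t \<and> t < p (Suc n)" "\<And>n. jt_norm (x n) \<le> 1"
    and mx: "\<And>n. 1/2 \<le> pairing (m n) (x n)"
    and tail: "\<And>j n y. j < n \<Longrightarrow> fin_supp y \<Longrightarrow> (\<And>t. t < p n \<Longrightarrow> y t = 0) \<Longrightarrow> \<bar>pairing (m j) y\<bar> \<le> \<delta> n * jt_norm y"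
  proof (rule norming_block_sequence[where \<delta> = \<delta>, OF assms(1,2,4) \<delta>_pos], goal_cases)
    case 1
    from 1(2-) show ?case by (rule 1(1))
  qed
  obtain r :: "nat \<Rightarrow> nat" where r: "strict_mono r" "branch_null (\<lambda>n t. x (r (Suc (2 * n))) t - x (r (2 * n)) t)"
    using branch_null_differences[where x = x, OF x(1,3) p x(2)] by blast
  \<comment> \<open>The exponent \<open>p (Suc (r (Suc (2 * n))))\<close> is the end of the block of
    the n-th difference, which becomes \<open>hi\<close>.\<close>
  obtain s :: "nat \<Rightarrow> nat" where s: "strict_mono s"
    and drop: "\<And>n k v. n < k \<Longrightarrow>
      (1/2) ^ p (Suc (r (Suc (2 * s n)))) \<le> \<bar>asum v (\<lambda>t. x (r (Suc (2 * s (Suc k)))) t - x (r (2 * s (Suc k))) t)\<bar> \<Longrightarrow>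
      \<bar>asum v (\<lambda>t. x (r (Suc (2 * s (Suc n)))) t - x (r (2 * s (Suc n))) t)\<bar> < (1/2) ^ p (Suc (r (Suc (2 * s n))))"
    by (rule branch_null_fast_subsequence[OF r(2), of "\<lambda>n. (1/2) ^ p (Suc (r (Suc (2 * n))))"]) auto
  define a b where "a k = r (2 * s k)" and "b k = r (Suc (2 * s k))" for k
  have ab: "a k < b k" "b k < a (Suc k)" for k
  proof -
    show "a k < b k" using r(1) by (simp add: a_def b_def strict_mono_less)
    have "s k < s (Suc k)" using s by (simp add: strict_mono_Suc_iff)
    then show "b k < a (Suc k)" using r(1) by (simp add: a_def b_def strict_mono_less)
  qed
  have a: "strict_mono a" using ab by (simp add: strict_mono_Suc_iff) (meson less_trans)
  have b_less: "b n < a k" if "n < k" for n k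
  proof -
    have "a (Suc n) \<le> a k" using a that by (simp add: strict_mono_less_eq)
    then show ?thesis using ab(2)[of n] by simp
  qed
  define lo hi where "lo k = p (a k)" and "hi k = p (Suc (b k))" for k
  define g where "g k = (\<lambda>t. m (b k) t - m (a k) t)" for k
  define z where "z k = (\<lambda>t. x (b k) t - x (a k) t)" for k
  have lo: "strict_mono lo" unfolding lo_def using p a by (simp add: strict_mono_def)
  have blocks: "lo k < hi k" "hi k \<le> lo (Suc k)" for k
    using p ab[of k] by (auto simp: lo_def hi_def strict_mono_less strict_mono_less_eq Suc_le_eq)
  have hi_lo: "hi n \<le> lo k" if "n < k" for n k
    using p b_less[OF that] by (simp add: lo_def hi_def strict_mono_less_eq Suc_le_eq)
  have pab: "p (a k) \<le> p (b k)" "p (Suc (a k)) \<le> p (b k)" "p (b k) \<le> p (Suc (b k))" for k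
    using p ab(1)[of k] by (auto simp: strict_mono_less_eq Suc_le_eq)
  have z_fin: "fin_supp (z k)" for k unfolding z_def by (intro fin_supp_diff x)
  have z_le: "jt_norm (z k) \<le> 2" for k
    unfolding z_def using jt_norm_diff_le[OF x(1) x(1), of "b k" "a k"] x(3)[of "b k"] x(3)[of "a k"] by linarith
  have z_supp: "lo k \<le> t \<and> t < hi k" if "z k t \<noteq> 0" for k t
  proof -
    have "x (b k) t \<noteq> 0 \<or> x (a k) t \<noteq> 0" using that by (auto simp: z_def)
    then show ?thesis using x(2)[of "b k" t] x(2)[of "a k" t] pab[of k] by (auto simp: lo_def hi_def)
  qed
  have z_upper: "jt_norm (\<lambda>t. \<Sum>n<N. c n * z n t) \<le> sqrt (3 * 2\<^sup>2 + 16) * L2_set c {..<N}" for N c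
  proof (rule jt_upper_2_estimate[where lo = lo and hi = hi])
    show "\<bar>asum v (z (Suc n))\<bar> < (1/2) ^ hi n" if "n < k" "(1/2) ^ hi n \<le> \<bar>asum v (z (Suc k))\<bar>" for n k v
      using drop[of n k v] that by (simp add: z_def hi_def a_def b_def)
  qed (use z_fin z_le z_supp blocks in auto)
  have g_M: "g k \<in> M" for k
  proof -
    have "(\<lambda>t. m (b k) t + (- 1) * m (a k) t) \<in> M"
      by (intro lin_subspace_add[OF assms(2)] lin_subspace_mult[OF assms(2)] m(1))
    then show ?thesis by (simp add: g_def)
  qed
  have g_zero: "g k t = 0" if "t < lo k" for k t
    using that m(3)[of t "a k"] m(3)[of t "b k"] pab(1)[of k] by (auto simp: g_def lo_def)
  have g_le: "B_le 2 (g k)" for k using B_le_diff[OF m(2) m(2), of "b k" "a k"] by (simp add: g_def)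
  \<comment> \<open>Both indices \<open>a n\<close> and \<open>b n\<close> lie below
    \<open>a k\<close>, where the tail bound applies; \<open>k \<le> a k\<close> then replaces
    \<open>\<delta> (a k)\<close> by \<open>\<delta> k\<close>.\<close>
  have g_tail: "\<bar>pairing (g n) y\<bar> \<le> 2 * \<delta> k * jt_norm y"
    if "n < k" "fin_supp y" "\<And>t. t < lo k \<Longrightarrow> y t = 0" for n k y
  proof -
    have "\<bar>pairing (m (b n)) y\<bar> \<le> \<delta> (a k) * jt_norm y" "\<bar>pairing (m (a n)) y\<bar> \<le> \<delta> (a k) * jt_norm y"
      using b_less[OF that(1)] ab(1)[of n] that by (auto intro!: tail simp: lo_def)
    then have "\<bar>pairing (g n) y\<bar> \<le> 2 * \<delta> (a k) * jt_norm y"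
      unfolding g_def pairing_diff_left by linarith
    also have "\<dots> \<le> 2 * \<delta> k * jt_norm y"
      using \<delta>_mono[OF seq_suble[OF a, of k]] jt_norm_nonneg[OF that(2)] by (intro mult_right_mono) auto
    finally show ?thesis .
  qed
  have g_upper: "B_le (6 * L2_set c {..<N}) (\<lambda>t. \<Sum>n<N. c n * g n t)" for N c
  proof -
    have "\<bar>pairing (g n) y\<bar> \<le> 2 * (1/2) ^ n * jt_norm y"
      if y: "fin_supp y" "\<And>t. t < lo (Suc n) \<Longrightarrow> y t = 0" for n y
    proof -
      have "2 * \<delta> (Suc n) \<le> 2 * (1/2) ^ n" 
        using \<delta>_mono[of n "Suc n"] \<delta>_le[of n] \<delta>_pos[of n] by linarith
      then have "2 * \<delta> (Suc n) * jt_norm y \<le> 2 * (1/2) ^ n * jt_norm y"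
        by (intro mult_right_mono jt_norm_nonneg y)
      moreover have "\<bar>pairing (g n) y\<bar> \<le> 2 * \<delta> (Suc n) * jt_norm y"
        using y by (intro g_tail) auto
      ultimately show ?thesis by linarith
    qed
    then have "B_le (3 * 2 * L2_set c {..<N}) (\<lambda>t. \<Sum>n<N. c n * g n t)"
      by (intro B_upper_2_estimate[where q = lo] g_zero g_le strict_mono_mono lo) auto
    then show ?thesis by simp
  qed
  have off_zero: "pairing (g n) (z k) = 0" if "k < n" for n k
  proof (rule pairing_eq_0)
    fix t show "g n t * z k t = 0"
      using g_zero[of t n] z_supp[of k t] hi_lo[OF that] by (cases "t < lo n") auto
  qed
  have off_small: "(\<Sum>n<k. \<bar>pairing (g n) (z k)\<bar>) \<le> 1/4 * (1/2) ^ k" for k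
  proof -
    have "(\<Sum>n<k. \<bar>pairing (g n) (z k)\<bar>) \<le> (\<Sum>n<k. 4 * \<delta> k)"
    proof (rule sum_mono)
      fix n assume "n \<in> {..<k}"
      then have "\<bar>pairing (g n) (z k)\<bar> \<le> 2 * \<delta> k * jt_norm (z k)"
        using z_supp[of k] by (intro g_tail z_fin) force+
      also have "\<dots> \<le> 2 * \<delta> k * 2" using z_le[of k] \<delta>_pos[of k] by (intro mult_left_mono) auto
      finally show "\<bar>pairing (g n) (z k)\<bar> \<le> 4 * \<delta> k" by simp
    qed
    also have "\<dots> = (real k / (real k + 1)) * (1/4 * (1/2) ^ k)"
    proof -
      have "i * (4 * (q / (16 * d))) = (i / d) * (1/4 * q)" for i q d :: real by simp
      then show ?thesis unfolding \<delta>_def sum_constant card_lessThan .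
    qed
    also have "\<dots> \<le> 1 * (1/4 * (1/2) ^ k)" by (intro mult_right_mono) auto
    finally show ?thesis by simp
  qed
  \<comment> \<open>Of the four pairings, two are at least 1/2, \<open>m (b k)\<close> vanishes on
    the earlier block \<open>x (a k)\<close>, and \<open>m (a k)\<close> on the later block
    \<open>x (b k)\<close> is a tail of size at most 1/2.\<close>
  have diag: "1/2 \<le> pairing (g k) (z k)" for k
  proof -
    have "m (b k) t * x (a k) t = 0" for t
      using m(3)[of t "b k"] x(2)[of "a k" t] pab(2)[of k] by (cases "t < p (b k)") auto
    then have "pairing (m (b k)) (x (a k)) = 0" by (rule pairing_eq_0)
    moreover have "\<bar>pairing (m (a k)) (x (b k))\<bar> \<le> \<delta> (b k) * jt_norm (x (b k))"
      using ab(1)[of k] x(1) x(2)[of "b k"] by (intro tail) force+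
    moreover have "\<delta> (b k) * jt_norm (x (b k)) \<le> 1/2 * 1"
    proof (intro mult_mono x jt_norm_nonneg)
      have "(1/2 :: real) ^ b k \<le> 1" by (rule power_le_one) auto
      then show "\<delta> (b k) \<le> 1/2" using \<delta>_le[of "b k"] by linarith
    qed simp
    ultimately show ?thesis
      unfolding g_def z_def pairing_diff_left
      using mx[of "a k"] mx[of "b k"] by (simp add: pairing_diff[OF x(1) x(1)])
  qed
  \<comment> \<open>A single constant must bound both the norms of the \<open>z k\<close> and their
    upper 2-estimate.\<close>
  have K: "2 \<le> sqrt (3 * 2\<^sup>2 + 16)" by (rule real_le_rsqrt) simp
  obtain w where w: "\<And>k. fin_supp (w k)" "\<And>n k. pairing (g n) (w k) = (if n = k then 1 else 0)"
    "\<And>N c. jt_norm (\<lambda>t. \<Sum>n<N. c n * w n t) \<le> 6 * sqrt (3 * 2\<^sup>2 + 16) * L2_set c {..<N}"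
    by (rule biorthogonal_perturbation[of z "sqrt (3 * 2\<^sup>2 + 16)" g])
      (use z_fin order_trans[OF z_le K] off_zero diag off_small z_upper in blast)+
  show ?thesis
  proof (rule complemented_l2_criterion[OF assms(1-3) g_M _ w(1,2) g_upper _ w(3)])
    show "g n t = 0" if "t < n" for n t
      using g_zero[of t n] seq_suble[OF lo, of n] that by simp
  qed auto
qed

end
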